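(* Let $n\ge2$. Let $Q_0$ be the permutation $S_n$-lattice with basis $\{y_{ij}:1\le i\ne j\le n\}$ (so $Q_0\cong\mathbb{Z}[S_n/S_{n-2}]$), and for each prime $p$ dividing $n$ let $Q_p$ be the permutation $S_n$-lattice with basis $$\{y_{I,J}:\emptyset\ne I,J\subseteq[1,n],\ I\cap J=\emptyset,\ |I|=p^r,\ |J|=p^s,\ 1\le r\le s\}.$$ Then the $S_n$-equivariant map $$Q_0\oplus\bigoplus_{p\mid n}Q_p\to\mathbb{Z}A_{n-1},\qquad y_{ij}\mapsto\mathbf{e}_i-\mathbf{e}_j,\quad y_{I,J}\mapsto s_{I,J},$$ is a surjection that determines an $S_n$-coflasque resolution of $\mathbb{Z}A_{n-1}$; that is, its kernel is a coflasque $S_n$-lattice.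
   Context: $\mathbb{Z}A_{n-1}=\{x\in\mathbb{Z}^n:\sum x_i=0\}$ is the root lattice with $S_n$ permuting the standard basis $\mathbf{e}_1,\dots,\mathbf{e}_n$ of $\mathbb{Z}^n$. $[1,n]=\{1,\dots,n\}$. For disjoint nonempty $I,J\subseteq[1,n]$, $s_{I,J}=\dfrac{|J|\sum_{i\in I}\mathbf{e}_i-|I|\sum_{j\in J}\mathbf{e}_j}{\gcd(|I|,|J|)}$. $S_n$ acts on the bases by $\sigma y_{ij}=y_{\sigma(i)\sigma(j)}$ and $\sigma y_{I,J}=y_{\sigma(I),\sigma(J)}$. A $G$-lattice $F$ is coflasque if $H^1(H,F)=0$ for all subgroups $H\le G$; a coflasque resolution of a $G$-lattice $N$ is an exact sequence of $G$-lattices $0\to F\to P\to N\to0$ with $P$ a permutation lattice and $F$ coflasque. *)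

theory Defs
  imports
    "HOL-Algebra.Sym_Groups"
    "HOL-Algebra.Free_Abelian_Groups"
    "HOL-Computational_Algebra.Primes"
begin

section \<open>Lattices with a group action\<close>

text \<open>Abelian groups are written multiplicatively, as in HOL-Algebra. A subset \<open>B\<close> is a
  basis of \<open>L\<close> over the integers if the homomorphism from the free abelian group on \<open>B\<close>
  that is the identity on \<open>B\<close> is an isomorphism.\<close>

definition Z_basis :: "('a, 'm) monoid_scheme \<Rightarrow> 'a set \<Rightarrow> bool" where
  "Z_basis L B \<longleftrightarrow>
     B \<subseteq> carrier L \<and> (\<exists>h \<in> iso (free_Abelian_group B) L. \<forall>b\<in>B. h (frag_of b) = b)"

locale G_lattice = G: group G + L: comm_group L
  for G :: "('g, 'm) monoid_scheme" and L :: "('a, 'k) monoid_scheme"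
    and act :: "'g \<Rightarrow> 'a \<Rightarrow> 'a" +
  assumes finitely_generated_free: "\<exists>B. finite B \<and> Z_basis L B"
    and act_hom: "g \<in> carrier G \<Longrightarrow> act g \<in> hom L L"
    and act_one: "x \<in> carrier L \<Longrightarrow> act \<one>\<^bsub>G\<^esub> x = x"
    and act_mult: "\<lbrakk>g \<in> carrier G; h \<in> carrier G; x \<in> carrier L\<rbrakk>
                     \<Longrightarrow> act (g \<otimes>\<^bsub>G\<^esub> h) x = act g (act h x)"

definition permutation_lattice ::
    "('g, 'm) monoid_scheme \<Rightarrow> ('a, 'k) monoid_scheme \<Rightarrow> ('g \<Rightarrow> 'a \<Rightarrow> 'a) \<Rightarrow> bool" where
  "permutation_lattice G L act \<longleftrightarrow>
     G_lattice G L act \<and>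
     (\<exists>B. finite B \<and> Z_basis L B \<and> (\<forall>g\<in>carrier G. act g ` B \<subseteq> B))"

definition equivariant ::
    "('g, 'm) monoid_scheme \<Rightarrow> ('a, 'k) monoid_scheme \<Rightarrow> ('g \<Rightarrow> 'a \<Rightarrow> 'a) \<Rightarrow> ('g \<Rightarrow> 'b \<Rightarrow> 'b)
      \<Rightarrow> ('a \<Rightarrow> 'b) \<Rightarrow> bool" where
  "equivariant G L act act' f \<longleftrightarrow>
     (\<forall>g\<in>carrier G. \<forall>x\<in>carrier L. f (act g x) = act' g (f x))"


section \<open>First cohomology by inhomogeneous cochains\<close>

definition cocycle_group ::
    "('g, 'm) monoid_scheme \<Rightarrow> ('a, 'k) monoid_scheme \<Rightarrow> ('g \<Rightarrow> 'a \<Rightarrow> 'a) \<Rightarrow> ('g \<Rightarrow> 'a) monoid"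
  where
  "cocycle_group G L act =
     \<lparr>carrier = {f \<in> carrier G \<rightarrow>\<^sub>E carrier L.
                  \<forall>g\<in>carrier G. \<forall>h\<in>carrier G. f (g \<otimes>\<^bsub>G\<^esub> h) = f g \<otimes>\<^bsub>L\<^esub> act g (f h)},
      mult = (\<lambda>f f'. \<lambda>g\<in>carrier G. f g \<otimes>\<^bsub>L\<^esub> f' g),
      one = (\<lambda>g\<in>carrier G. \<one>\<^bsub>L\<^esub>)\<rparr>"

definition coboundaries ::
    "('g, 'm) monoid_scheme \<Rightarrow> ('a, 'k) monoid_scheme \<Rightarrow> ('g \<Rightarrow> 'a \<Rightarrow> 'a) \<Rightarrow> ('g \<Rightarrow> 'a) set" where
  "coboundaries G L act =
     (\<lambda>a. \<lambda>g\<in>carrier G. act g a \<otimes>\<^bsub>L\<^esub> inv\<^bsub>L\<^esub> a) ` carrier L"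

definition H1 ::
    "('g, 'm) monoid_scheme \<Rightarrow> ('a, 'k) monoid_scheme \<Rightarrow> ('g \<Rightarrow> 'a \<Rightarrow> 'a) \<Rightarrow> ('g \<Rightarrow> 'a) set monoid"
  where
  "H1 G L act = cocycle_group G L act Mod coboundaries G L act"

definition coflasque ::
    "('g, 'm) monoid_scheme \<Rightarrow> ('a, 'k) monoid_scheme \<Rightarrow> ('g \<Rightarrow> 'a \<Rightarrow> 'a) \<Rightarrow> bool" where
  "coflasque G L act \<longleftrightarrow>
     G_lattice G L act \<and> (\<forall>H. subgroup H G \<longrightarrow> trivial_group (H1 (G\<lparr>carrier := H\<rparr>) L act))"

definition coflasque_resolution ::
    "('g, 'm) monoid_scheme \<Rightarrow>
     ('f, 'k1) monoid_scheme \<Rightarrow> ('g \<Rightarrow> 'f \<Rightarrow> 'f) \<Rightarrow>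
     ('p, 'k2) monoid_scheme \<Rightarrow> ('g \<Rightarrow> 'p \<Rightarrow> 'p) \<Rightarrow>
     ('n, 'k3) monoid_scheme \<Rightarrow> ('g \<Rightarrow> 'n \<Rightarrow> 'n) \<Rightarrow>
     ('f \<Rightarrow> 'p) \<Rightarrow> ('p \<Rightarrow> 'n) \<Rightarrow> bool" where
  "coflasque_resolution G F actF P actP N actN \<iota> \<pi> \<longleftrightarrow>
     G_lattice G N actN \<and> permutation_lattice G P actP \<and> coflasque G F actF \<and>
     \<iota> \<in> mon F P \<and> equivariant G F actF actP \<iota> \<and>
     \<pi> \<in> epi P N \<and> equivariant G P actP actN \<pi> \<and>
     \<iota> ` carrier F = kernel P N \<pi>"


section \<open>The root lattice and the permutation lattices over the symmetric group\<close>

text \<open>The lattice \<open>\<int>\<^sup>n\<close> is \<open>free_Abelian_group {1..n}\<close>, with \<open>frag_of i\<close> as its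
  \<open>i\<close>-th standard basis vector.\<close>

definition root_lattice :: "nat \<Rightarrow> (nat \<Rightarrow>\<^sub>0 int) monoid" where
  "root_lattice n =
     (free_Abelian_group {1..n})
       \<lparr>carrier := {x \<in> carrier (free_Abelian_group {1..n}).
                     (\<Sum>i\<in>{1..n}. Poly_Mapping.lookup x i) = 0}\<rparr>"

definition linear_perm :: "('b \<Rightarrow> 'b) \<Rightarrow> ('b \<Rightarrow>\<^sub>0 int) \<Rightarrow> ('b \<Rightarrow>\<^sub>0 int)" where
  "linear_perm f = frag_extend (\<lambda>b. frag_of (f b))"

definition root_act :: "(nat \<Rightarrow> nat) \<Rightarrow> (nat \<Rightarrow>\<^sub>0 int) \<Rightarrow> (nat \<Rightarrow>\<^sub>0 int)" where
  "root_act \<sigma> = linear_perm \<sigma>"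

text \<open>The integer divisions are exact.\<close>

definition s_vec :: "nat set \<Rightarrow> nat set \<Rightarrow> (nat \<Rightarrow>\<^sub>0 int)" where
  "s_vec I J =
     frag_cmul (int (card J) div gcd (int (card I)) (int (card J))) (\<Sum>i\<in>I. frag_of i)
   - frag_cmul (int (card I) div gcd (int (card I)) (int (card J))) (\<Sum>j\<in>J. frag_of j)"

definition Q0_basis :: "nat \<Rightarrow> (nat \<times> nat) set" where
  "Q0_basis n = {(i, j). i \<in> {1..n} \<and> j \<in> {1..n} \<and> i \<noteq> j}"

definition Q0 :: "nat \<Rightarrow> (nat \<times> nat \<Rightarrow>\<^sub>0 int) monoid" where
  "Q0 n = free_Abelian_group (Q0_basis n)"

definition Q0_act :: "(nat \<Rightarrow> nat) \<Rightarrow> (nat \<times> nat \<Rightarrow>\<^sub>0 int) \<Rightarrow> (nat \<times> nat \<Rightarrow>\<^sub>0 int)" where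
  "Q0_act \<sigma> = linear_perm (\<lambda>(i, j). (\<sigma> i, \<sigma> j))"

definition Qp_basis :: "nat \<Rightarrow> nat \<Rightarrow> (nat set \<times> nat set) set" where
  "Qp_basis n p =
     {(I, J). I \<subseteq> {1..n} \<and> J \<subseteq> {1..n} \<and> I \<noteq> {} \<and> J \<noteq> {} \<and> I \<inter> J = {} \<and>
              (\<exists>r s. 1 \<le> r \<and> r \<le> s \<and> card I = p ^ r \<and> card J = p ^ s)}"

definition Qp :: "nat \<Rightarrow> nat \<Rightarrow> (nat set \<times> nat set \<Rightarrow>\<^sub>0 int) monoid" where
  "Qp n p = free_Abelian_group (Qp_basis n p)"

definition Qp_act ::
    "(nat \<Rightarrow> nat) \<Rightarrow> (nat set \<times> nat set \<Rightarrow>\<^sub>0 int) \<Rightarrow> (nat set \<times> nat set \<Rightarrow>\<^sub>0 int)" where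
  "Qp_act \<sigma> = linear_perm (\<lambda>(I, J). (\<sigma> ` I, \<sigma> ` J))"

definition prime_divs :: "nat \<Rightarrow> nat set" where
  "prime_divs n = {p. prime p \<and> p dvd n}"

type_synonym Q_elem = "(nat \<times> nat \<Rightarrow>\<^sub>0 int) \<times> (nat \<Rightarrow> (nat set \<times> nat set \<Rightarrow>\<^sub>0 int))"

definition Q_sum :: "nat \<Rightarrow> Q_elem monoid" where
  "Q_sum n = Q0 n \<times>\<times> sum_group (prime_divs n) (Qp n)"

definition Q_act :: "nat \<Rightarrow> (nat \<Rightarrow> nat) \<Rightarrow> Q_elem \<Rightarrow> Q_elem" where
  "Q_act n \<sigma> = (\<lambda>(x, z). (Q0_act \<sigma> x, \<lambda>p\<in>prime_divs n. Qp_act \<sigma> (z p)))"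

definition resolution_map :: "nat \<Rightarrow> Q_elem \<Rightarrow> (nat \<Rightarrow>\<^sub>0 int)" where
  "resolution_map n = (\<lambda>(x, z).
     frag_extend (\<lambda>(i, j). frag_of i - frag_of j) x
     + (\<Sum>p\<in>prime_divs n. frag_extend (\<lambda>(I, J). s_vec I J) (z p)))"

definition resolution_kernel :: "nat \<Rightarrow> Q_elem monoid" where
  "resolution_kernel n =
     (Q_sum n)\<lparr>carrier := kernel (Q_sum n) (root_lattice n) (resolution_map n)\<rparr>"

text \<open>The lattice \<open>\<int>[G/H]\<close> on the left cosets of \<open>H\<close>, with \<open>G\<close> acting by left translation.\<close>

definition coset_lattice :: "('g, 'm) monoid_scheme \<Rightarrow> 'g set \<Rightarrow> ('g set \<Rightarrow>\<^sub>0 int) monoid" where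
  "coset_lattice G H = free_Abelian_group ((\<lambda>g. g <#\<^bsub>G\<^esub> H) ` carrier G)"

definition coset_act ::
    "('g, 'm) monoid_scheme \<Rightarrow> 'g \<Rightarrow> ('g set \<Rightarrow>\<^sub>0 int) \<Rightarrow> ('g set \<Rightarrow>\<^sub>0 int)" where
  "coset_act G g = linear_perm (\<lambda>C. g <#\<^bsub>G\<^esub> C)"

end

theory Submission
  imports Defs "HOL-Algebra.Exponent"
begin

text \<open>
  Two facts carry the proof. The first is that \<open>H\<^sup>1(H, P) = 0\<close> for a permutation lattice \<open>P\<close>
  (\<open>permutation_cocycle_is_coboundary\<close>). Hence, for an equivariant surjection \<open>P \<rightarrow> N\<close> with kernel \<open>F\<close>,
  the long exact sequence identifies \<open>H\<^sup>1(H, F)\<close> with the cokernel of \<open>P\<^sup>H \<rightarrow> N\<^sup>H\<close>, and \<open>F\<close> is coflasque as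
  soon as every \<open>x \<in> N\<close> has a preimage fixed by the whole stabiliser of \<open>x\<close>
  (\<open>coflasque_resolution_kernelI\<close>). This condition also contains surjectivity.

  The second fact (\<open>self_liftable\<close>) is that the resolution map has this lifting property. A root
  vector \<open>x\<close> is an integral combination of the indicator vectors \<open>1\<^sub>O\<close> of its level sets \<open>O\<close>, and the
  stabiliser of \<open>x\<close> maps every level set to itself. The liftable multiples of \<open>x\<close> form an ideal of the
  integers, so it suffices to lift, for each prime \<open>p\<close>, some multiple of \<open>x\<close> prime to \<open>p\<close>. Choose a
  level set \<open>O\<close> whose size has minimal \<open>p\<close>-adic valuation \<open>r\<close>. For every other level set \<open>O'\<close> there is a
  liftable vector \<open>\<alpha> 1\<^sub>O - \<beta> 1\<^sub>O\<^sub>'\<close> with \<open>\<beta>\<close> prime to \<open>p\<close> (\<open>liftable_pair\<close>): if \<open>r = 0\<close>, it is the image of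
  the sum of all \<open>y\<^sub>i\<^sub>j\<close> with \<open>i \<in> O\<close>, \<open>j \<in> O'\<close>, where \<open>\<beta> = |O|\<close>; if \<open>r \<ge> 1\<close>, then \<open>p\<close> divides all level sizes
  and therefore \<open>n\<close>, and it is the image of the sum of all \<open>y\<^bsub>I,J\<^esub>\<close> with \<open>I \<subseteq> O\<close>, \<open>J \<subseteq> O'\<close> such that
  \<open>|I|\<close> and \<open>|J|\<close> are the exact powers of \<open>p\<close> dividing \<open>|O|\<close> and \<open>|O'|\<close>, where \<open>\<beta>\<close> is a product of two binomial coefficients prime to \<open>p\<close>.
  These vectors eliminate all level sets but \<open>O\<close> from a multiple of \<open>x\<close> prime to \<open>p\<close>, and what remains is
  a multiple of \<open>1\<^sub>O\<close> with coordinate sum zero, hence zero.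
\<close>


section \<open>Lattices and their bases\<close>

text \<open>The functor from sets to free abelian groups. It agrees with \<open>linear_perm\<close>, but the two
  sets may have different types, as they do when \<open>\<int>[S]\<close> is compared with a lattice whose basis is
  indexed by \<open>S\<close>.\<close>

definition frag_map :: "('a \<Rightarrow> 'b) \<Rightarrow> ('a \<Rightarrow>\<^sub>0 int) \<Rightarrow> ('b \<Rightarrow>\<^sub>0 int)" where
  "frag_map f = frag_extend (\<lambda>b. frag_of (f b))"

lemma linear_perm_eq_frag_map: "linear_perm = frag_map"
  by (simp add: fun_eq_iff linear_perm_def frag_map_def)

lemma frag_map_frag_of [simp]: "frag_map f (frag_of b) = frag_of (f b)"
  by (simp add: frag_map_def)

lemma frag_map_0 [simp]: "frag_map f 0 = 0"
  by (simp add: frag_map_def)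

lemma frag_map_add: "frag_map f (x + y) = frag_map f x + frag_map f y"
  by (simp add: frag_map_def frag_extend_add)

lemma frag_map_diff: "frag_map f (x - y) = frag_map f x - frag_map f y"
  by (simp add: frag_map_def frag_extend_diff)

lemma frag_map_cmul: "frag_map f (frag_cmul c x) = frag_cmul c (frag_map f x)"
  by (simp add: frag_map_def frag_extend_cmul)

lemma frag_map_sum: "frag_map f (\<Sum>i\<in>I. x i) = (\<Sum>i\<in>I. frag_map f (x i))"
  by (induction I rule: infinite_finite_induct) (auto simp: frag_map_add)

lemma frag_map_compose: "frag_map f (frag_map g x) = frag_map (f \<circ> g) x"
  using frag_extend_compose[of "frag_of \<circ> f" g x] by (simp add: frag_map_def comp_def)

lemma frag_map_id [simp]: "frag_map id x = x" "frag_map (\<lambda>b. b) x = x"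
  by (simp_all add: frag_map_def id_def frag_expansion[symmetric])

lemma frag_map_cong:
  "(\<And>b. b \<in> Poly_Mapping.keys x \<Longrightarrow> f b = g b) \<Longrightarrow> frag_map f x = frag_map g x"
  unfolding frag_map_def by (rule frag_extend_eq) simp

lemma keys_frag_map: "Poly_Mapping.keys (frag_map f x) \<subseteq> f ` Poly_Mapping.keys x"
  using keys_frag_extend[of "\<lambda>b. frag_of (f b)" x] by (auto simp: frag_map_def)

lemma keys_frag_map_subset:
  assumes "Poly_Mapping.keys x \<subseteq> S" "\<And>b. b \<in> S \<Longrightarrow> f b \<in> T"
  shows "Poly_Mapping.keys (frag_map f x) \<subseteq> T"
proof
  fix c assume "c \<in> Poly_Mapping.keys (frag_map f x)"
  then obtain b where "b \<in> Poly_Mapping.keys x" "c = f b" using keys_frag_map[of f x] by blast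
  then show "c \<in> T" using assms by blast
qed

lemma carrier_frag_map:
  assumes "x \<in> carrier (free_Abelian_group S)"
  shows "frag_map f x \<in> carrier (free_Abelian_group (f ` S))"
  using assms keys_frag_map[of f x] by fastforce

lemma lookup_frag_map:
  assumes "inj_on f S" "Poly_Mapping.keys x \<subseteq> S" "b \<in> S"
  shows "Poly_Mapping.lookup (frag_map f x) (f b) = Poly_Mapping.lookup x b"
  using assms(2)
proof (induction x rule: frag_induction)
  case (one c)
  then show ?case using assms(1,3) by (auto simp: inj_on_def)
next
  case (diff x y)
  then show ?case by (simp add: frag_map_def frag_extend_diff lookup_minus)
qed simp

lemma frag_extend_frag_map: "frag_extend F (frag_map f x) = frag_extend (F \<circ> f) x"
  using frag_extend_compose[of F f x] by (simp add: frag_map_def comp_def)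

lemma frag_map_frag_extend:
  "frag_map f (frag_extend F x) = frag_extend (\<lambda>b. frag_map f (F b)) x"
using subset_UNIV[of "Poly_Mapping.keys x"]
  by (induction x rule: frag_induction) (simp_all add: frag_extend_diff frag_map_def)

lemma frag_extend_hom:
  assumes "\<And>b. b \<in> S \<Longrightarrow> Poly_Mapping.keys (F b) \<subseteq> T"
  shows "frag_extend F \<in> hom (free_Abelian_group S) (free_Abelian_group T)"
proof (rule homI)
  fix x assume "x \<in> carrier (free_Abelian_group S)"
  then have "(\<Union>b\<in>Poly_Mapping.keys x. Poly_Mapping.keys (F b)) \<subseteq> T" using assms by auto
  then show "frag_extend F x \<in> carrier (free_Abelian_group T)"
    using keys_frag_extend[of F x] by simp
qed (simp add: frag_extend_add)

lemma iso_frag_map: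
  assumes "bij_betw f S T"
  shows "frag_map f \<in> iso (free_Abelian_group S) (free_Abelian_group T)"
proof -
  let ?g = "inv_into S f"
  have fg: "bij_betw ?g T S" using assms by (rule bij_betw_inv_into)
  have "bij_betw (frag_map f) (carrier (free_Abelian_group S)) (carrier (free_Abelian_group T))"
  proof (rule bij_betw_byWitness[where f' = "frag_map ?g"])
    show "\<forall>x\<in>carrier (free_Abelian_group S). frag_map ?g (frag_map f x) = x"
    proof
      fix x :: "'a \<Rightarrow>\<^sub>0 int" assume "x \<in> carrier (free_Abelian_group S)"
      then have "frag_map (?g \<circ> f) x = frag_map id x"
        using bij_betw_inv_into_left[OF assms] by (intro frag_map_cong) auto
      then show "frag_map ?g (frag_map f x) = x" by (simp add: frag_map_compose)
    qed
    show "\<forall>y\<in>carrier (free_Abelian_group T). frag_map f (frag_map ?g y) = y"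
    proof
      fix y :: "'b \<Rightarrow>\<^sub>0 int" assume "y \<in> carrier (free_Abelian_group T)"
      then have "frag_map (f \<circ> ?g) y = frag_map id y"
        using bij_betw_inv_into_right[OF assms] by (intro frag_map_cong) auto
      then show "frag_map f (frag_map ?g y) = y" by (simp add: frag_map_compose)
    qed
    show "frag_map f ` carrier (free_Abelian_group S) \<subseteq> carrier (free_Abelian_group T)"
      using carrier_frag_map[of _ S f] bij_betw_imp_surj_on[OF assms] by auto
    show "frag_map ?g ` carrier (free_Abelian_group T) \<subseteq> carrier (free_Abelian_group S)"
      using carrier_frag_map[of _ T ?g] bij_betw_imp_surj_on[OF fg] by auto
  qed
  moreover have "frag_map f \<in> hom (free_Abelian_group S) (free_Abelian_group T)"
    using bij_betw_imp_surj_on[OF assms] unfolding frag_map_def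
    by (intro frag_extend_hom) auto
  ultimately show ?thesis by (simp add: iso_def)
qed

text \<open>A basis in the sense of \<open>Z_basis\<close> is indexed by its own elements; here any index set \<open>S\<close> may
  take their place.\<close>

lemma Z_basis_iso_image:
  assumes "\<phi> \<in> iso (free_Abelian_group S) L"
  shows "Z_basis L ((\<lambda>s. \<phi> (frag_of s)) ` S)"
proof -
  let ?\<beta> = "\<lambda>s. \<phi> (frag_of s)"
  have inj: "inj_on \<phi> (carrier (free_Abelian_group S))"
    and car: "\<phi> ` carrier (free_Abelian_group S) = carrier L"
    using assms by (auto simp: iso_def bij_betw_def)
  have "inj_on ?\<beta> S"
    using inj by (intro inj_onI) (simp add: inj_on_eq_iff frag_of_eq)
  then have bij: "bij_betw ?\<beta> S (?\<beta> ` S)" by (simp add: bij_betw_def)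
  have "\<phi> \<circ> frag_map (inv_into S ?\<beta>) \<in> iso (free_Abelian_group (?\<beta> ` S)) L"
    by (rule iso_set_trans[OF iso_frag_map[OF bij_betw_inv_into[OF bij]] assms])
  moreover have "\<forall>b\<in>?\<beta> ` S. (\<phi> \<circ> frag_map (inv_into S ?\<beta>)) (frag_of b) = b"
    using f_inv_into_f[of _ ?\<beta> S] by simp
  moreover have "?\<beta> ` S \<subseteq> carrier L" using car by force
  ultimately show ?thesis unfolding Z_basis_def by blast
qed

text \<open>Needed twice: for the leading coordinates of a sublattice, and for the multiples of a root
  vector that can be lifted.\<close>

lemma int_subgroup_generator:
  fixes I :: "int set"
  assumes "0 \<in> I" "\<And>a b. a \<in> I \<Longrightarrow> b \<in> I \<Longrightarrow> a - b \<in> I"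
  obtains d where "d \<in> I" "\<And>a. a \<in> I \<Longrightarrow> d dvd a"
proof -
  have neg: "- a \<in> I" if "a \<in> I" for a using assms(2)[OF assms(1) that] by simp
  have add: "a + b \<in> I" if "a \<in> I" "b \<in> I" for a b using assms(2)[OF that(1) neg[OF that(2)]] by simp
  have mult_nat: "int k * a \<in> I" if "a \<in> I" for k a
    by (induction k) (use assms(1) add that in \<open>auto simp: algebra_simps\<close>)
  have mult: "k * a \<in> I" if "a \<in> I" for k a
    using mult_nat[OF that, of "nat k"] mult_nat[OF neg[OF that], of "nat (-k)"]
    by (cases "k \<ge> 0") auto
  show ?thesis
  proof (cases "I \<subseteq> {0}")
    case True
    then show ?thesis using that[of 0] assms(1) by auto
  next
    case False
    then obtain a where a: "a \<in> I" "a \<noteq> 0" by blast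
    then have ex: "\<exists>k. k > 0 \<and> int k \<in> I"
      using neg by (intro exI[of _ "nat \<bar>a\<bar>"]) (auto simp: abs_if)
    define d where "d = (LEAST k. k > 0 \<and> int k \<in> I)"
    have d: "d > 0" "int d \<in> I" using LeastI_ex[OF ex] by (auto simp: d_def)
    show ?thesis
    proof (rule that[OF d(2)])
      fix b assume b: "b \<in> I"
      have "b mod int d \<in> I"
        using assms(2)[OF b mult[OF d(2), of "b div int d"]] by (simp add: minus_div_mult_eq_mod)
      moreover have "nat (b mod int d) < d" using d by (simp add: nat_less_iff)
      ultimately have "\<not> 0 < nat (b mod int d)"
        using not_less_Least[of "nat (b mod int d)" "\<lambda>k. k > 0 \<and> int k \<in> I"] d(1)
        by (auto simp flip: d_def)
      then have "b mod int d = 0" using d(1) by (smt (verit) pos_mod_sign of_nat_0_less_iff zero_less_nat_eq)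
      then show "int d dvd b" by presburger
    qed
  qed
qed

text \<open>Gaussian elimination on one coordinate \<open>b\<close>: the \<open>b\<close>-coordinates of the subgroup form an
  ideal \<open>d\<int>\<close>, and an element with \<open>b\<close>-coordinate \<open>d\<close> splits off, unless \<open>d = 0\<close>.\<close>

lemma subgroup_free_Abelian_group_Z_basis:
  assumes "finite B" "subgroup M (free_Abelian_group B)"
  shows "\<exists>C. finite C \<and> C \<subseteq> M \<and>
           frag_extend id \<in> iso (free_Abelian_group C) ((free_Abelian_group B)\<lparr>carrier := M\<rparr>)"
  using assms
proof (induction B arbitrary: M rule: finite_induct)
  case empty
  then have "M = {0}"
    using subgroup.subset[OF empty] subgroup.one_closed[OF empty] by auto
  then show ?case
    by (intro exI[of _ "{}"]) (auto simp: iso_def hom_def bij_betw_def inj_on_def)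
next
  case (insert b B M)
  let ?F = "free_Abelian_group (insert b B)"
  interpret M: subgroup M ?F by fact
  have keysM: "Poly_Mapping.keys x \<subseteq> insert b B" if "x \<in> M" for x
    using subsetD[OF M.subset that] by simp
  have M0: "0 \<in> M" using M.one_closed by simp
  have Madd: "x + y \<in> M" if "x \<in> M" "y \<in> M" for x y using M.m_closed[OF that] by simp
  have Mneg: "- x \<in> M" if "x \<in> M" for x using M.m_inv_closed[OF that] keysM[OF that] by simp
  have Mdiff: "x - y \<in> M" if "x \<in> M" "y \<in> M" for x y
    using Madd[OF that(1) Mneg[OF that(2)]] by simp
  have Mcmul: "frag_cmul k x \<in> M" if "x \<in> M" for k x
    by (rule frag_closure_minus_cmul) (use M0 Mdiff that in auto)
  define M' where "M' = {x \<in> M. Poly_Mapping.lookup x b = 0}"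
  have M'_iff: "x \<in> M' \<longleftrightarrow> x \<in> M \<and> Poly_Mapping.keys x \<subseteq> B" for x
    using keysM[of x] insert.hyps by (auto simp: M'_def in_keys_iff)
  have "subgroup M' (free_Abelian_group B)"
  proof (rule group.subgroupI[OF group_free_Abelian_group])
    show "M' \<noteq> {}" using M0 M'_iff[of 0] by auto
    show "inv\<^bsub>free_Abelian_group B\<^esub> a \<in> M'" if "a \<in> M'" for a
      using that Mneg by (simp add: M'_iff)
    show "a \<otimes>\<^bsub>free_Abelian_group B\<^esub> c \<in> M'" if "a \<in> M'" "c \<in> M'" for a c
      using that Madd by (simp add: M'_def lookup_add)
  qed (auto simp: M'_iff)
  from insert.IH[OF this] obtain C where C: "finite C" "C \<subseteq> M'"
    and iso: "frag_extend id \<in> iso (free_Abelian_group C) ((free_Abelian_group B)\<lparr>carrier := M'\<rparr>)"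
    by blast
  have injC: "x = 0" if "Poly_Mapping.keys x \<subseteq> C" "frag_extend id x = 0" for x
  proof -
    have "inj_on (frag_extend id) (carrier (free_Abelian_group C))"
      using iso by (simp add: iso_def bij_betw_def)
    from inj_onD[OF this, of x 0] that show ?thesis by simp
  qed
  have surjC: "\<exists>x. Poly_Mapping.keys x \<subseteq> C \<and> frag_extend id x = m" if "m \<in> M'" for m
  proof -
    have "frag_extend id ` carrier (free_Abelian_group C) = M'"
      using iso by (simp add: iso_def bij_betw_def)
    with that have "m \<in> frag_extend id ` carrier (free_Abelian_group C)" by blast
    then obtain x where "x \<in> carrier (free_Abelian_group C)" "m = frag_extend id x" by blast
    then show ?thesis by (intro exI[of _ x]) simp
  qed
  have lookup0: "Poly_Mapping.lookup (frag_extend id x) b = 0" if "Poly_Mapping.keys x \<subseteq> C" for x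
    using that
  proof (induction x rule: frag_induction)
    case (one c) then show ?case using C by (auto simp: M'_def)
  qed (auto simp: frag_extend_diff lookup_minus)
  have isoI: "frag_extend id \<in> iso (free_Abelian_group D) (?F\<lparr>carrier := M\<rparr>)"
    if D: "D \<subseteq> M" and inj: "\<And>x. Poly_Mapping.keys x \<subseteq> D \<Longrightarrow> frag_extend id x = 0 \<Longrightarrow> x = 0"
      and surj: "\<And>m. m \<in> M \<Longrightarrow> \<exists>x. Poly_Mapping.keys x \<subseteq> D \<and> frag_extend id x = m" for D
  proof -
    have into: "frag_extend id x \<in> M" if "Poly_Mapping.keys x \<subseteq> D" for x
      using that
    proof (induction x rule: frag_induction)
      case (one c) then show ?case using D by auto
    qed (auto simp: M0 Mdiff frag_extend_diff)
    have "inj_on (frag_extend id) (carrier (free_Abelian_group D))"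
    proof (rule inj_onI)
      fix x y assume *: "x \<in> carrier (free_Abelian_group D)" "y \<in> carrier (free_Abelian_group D)"
        "frag_extend id x = frag_extend id y"
      have "Poly_Mapping.keys (x - y) \<subseteq> D"
        using * keys_diff[of x y] by auto
      with * have "x - y = 0" by (intro inj) (auto simp: frag_extend_diff)
      then show "x = y" by simp
    qed
    moreover have "frag_extend id ` carrier (free_Abelian_group D) = M"
    proof
      show "M \<subseteq> frag_extend id ` carrier (free_Abelian_group D)"
      proof
        fix m assume "m \<in> M"
        from surj[OF this] obtain x
          where "x \<in> carrier (free_Abelian_group D)" "m = frag_extend id x" by auto
        then show "m \<in> frag_extend id ` carrier (free_Abelian_group D)" by blast
      qed
    qed (use into in auto)
    ultimately show ?thesis
      using into by (simp add: iso_def bij_betw_def hom_def frag_extend_add)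
  qed
  obtain d where d: "d \<in> (\<lambda>x. Poly_Mapping.lookup x b) ` M"
      "\<And>a. a \<in> (\<lambda>x. Poly_Mapping.lookup x b) ` M \<Longrightarrow> d dvd a"
  proof (rule int_subgroup_generator[of "(\<lambda>x. Poly_Mapping.lookup x b) ` M"])
    show "0 \<in> (\<lambda>x. Poly_Mapping.lookup x b) ` M" using M0 by force
    show "a - a' \<in> (\<lambda>x. Poly_Mapping.lookup x b) ` M"
      if "a \<in> (\<lambda>x. Poly_Mapping.lookup x b) ` M" "a' \<in> (\<lambda>x. Poly_Mapping.lookup x b) ` M" for a a'
    proof -
      from that obtain x x' where "x \<in> M" "a = Poly_Mapping.lookup x b"
        "x' \<in> M" "a' = Poly_Mapping.lookup x' b" by blast
      then show ?thesis
        using Mdiff[of x x'] by (intro image_eqI[of _ _ "x - x'"]) (auto simp: lookup_minus)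
    qed
  qed auto
  from d(1) obtain m where m: "m \<in> M" "Poly_Mapping.lookup m b = d" by auto
  show ?case
  proof (cases "d = 0")
    case True
    then have "M = M'" using d(2) by (auto simp: M'_def)
    have "C \<subseteq> M" using C by (auto simp: M'_def)
    moreover from this have "frag_extend id \<in> iso (free_Abelian_group C) (?F\<lparr>carrier := M\<rparr>)"
      by (rule isoI[OF _ injC surjC[folded \<open>M = M'\<close>]])
    ultimately show ?thesis using C by blast
  next
    case False
    show ?thesis
    proof (intro exI[of _ "insert m C"] conjI isoI)
      show "finite (insert m C)" "insert m C \<subseteq> M" "insert m C \<subseteq> M"
        using C m by (auto simp: M'_def)
    next
      fix x assume x: "Poly_Mapping.keys x \<subseteq> insert m C" "frag_extend id x = 0"
      let ?y = "x - frag_cmul (Poly_Mapping.lookup x m) (frag_of m)"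
      have y: "Poly_Mapping.keys ?y \<subseteq> C"
        using x(1) by (auto simp: in_keys_iff lookup_minus split: if_splits)
      have "frag_extend id ?y = - frag_cmul (Poly_Mapping.lookup x m) m"
        using x(2) by (simp add: frag_extend_diff frag_extend_cmul)
      with lookup0[OF y] have "Poly_Mapping.lookup x m = 0"
        using m(2) False by simp
      then show "x = 0" using injC[OF y] x(2) by simp
    next
      fix z assume z: "z \<in> M"
      then obtain k where k: "Poly_Mapping.lookup z b = k * d"
        using d(2)[of "Poly_Mapping.lookup z b"] by (auto simp: dvd_def mult.commute)
      have "z - frag_cmul k m \<in> M'"
        using z m Mdiff Mcmul by (auto simp: M'_def lookup_minus k)
      then obtain x where "Poly_Mapping.keys x \<subseteq> C" "frag_extend id x = z - frag_cmul k m"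
        using surjC by blast
      then have "Poly_Mapping.keys (x + frag_cmul k (frag_of m)) \<subseteq> insert m C
        \<and> frag_extend id (x + frag_cmul k (frag_of m)) = z"
        using keys_add[of x "frag_cmul k (frag_of m)"]
        by (auto simp: frag_extend_add frag_extend_cmul split: if_splits)
      then show "\<exists>x. Poly_Mapping.keys x \<subseteq> insert m C \<and> frag_extend id x = z" by blast
    qed
  qed
qed

lemma subgroup_Z_basis:
  assumes "group L" "finite B" "Z_basis L B" "subgroup M L"
  shows "\<exists>C. finite C \<and> Z_basis (L\<lparr>carrier := M\<rparr>) C"
proof -
  obtain h where h: "h \<in> iso (free_Abelian_group B) L" using assms(3) by (auto simp: Z_basis_def)
  interpret h: group_hom "free_Abelian_group B" L h
    using h assms(1) by (simp add: group_hom_def group_hom_axioms_def iso_def)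
  define M' where "M' = {x \<in> carrier (free_Abelian_group B). h x \<in> M}"
  have M': "subgroup M' (free_Abelian_group B)"
  proof (rule h.G.subgroupI)
    show "M' \<noteq> {}"
    proof -
      have "\<one>\<^bsub>free_Abelian_group B\<^esub> \<in> M'"
        unfolding M'_def using subgroup.one_closed[OF assms(4)] h.hom_one h.G.one_closed
        by (simp del: one_free_Abelian_group)
      then show ?thesis by blast
    qed
    fix a b assume a: "a \<in> M'" and b: "b \<in> M'"
    show "inv\<^bsub>free_Abelian_group B\<^esub> a \<in> M'"
      using a subgroup.m_inv_closed[OF assms(4), of "h a"] h.G.inv_closed[of a] h.hom_inv[of a]
      unfolding M'_def by (metis (no_types, lifting) mem_Collect_eq)
    show "a \<otimes>\<^bsub>free_Abelian_group B\<^esub> b \<in> M'"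
      using a b subgroup.m_closed[OF assms(4), of "h a" "h b"] h.G.m_closed[of a b] h.hom_mult[of a b]
      unfolding M'_def by (metis (no_types, lifting) mem_Collect_eq)
  qed (auto simp: M'_def)
  then obtain C where C: "finite C"
    "frag_extend id \<in> iso (free_Abelian_group C) ((free_Abelian_group B)\<lparr>carrier := M'\<rparr>)"
    using subgroup_free_Abelian_group_Z_basis[OF assms(2)] by blast
  have inj: "inj_on h (carrier (free_Abelian_group B))"
    and car: "h ` carrier (free_Abelian_group B) = carrier L"
    using h by (auto simp: iso_def bij_betw_def)
  have "h ` M' = M"
  proof
    show "M \<subseteq> h ` M'"
    proof
      fix x assume x: "x \<in> M"
      then have "x \<in> h ` carrier (free_Abelian_group B)"
        unfolding car using subgroup.subset[OF assms(4)] by blast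
      then show "x \<in> h ` M'" using x unfolding M'_def by blast
    qed
  qed (auto simp: M'_def)
  moreover have "inj_on h M'"
    by (rule inj_on_subset[OF inj]) (auto simp: M'_def)
  moreover have "M' \<subseteq> carrier (free_Abelian_group B)" by (auto simp: M'_def)
  ultimately have "h \<in> iso ((free_Abelian_group B)\<lparr>carrier := M'\<rparr>) (L\<lparr>carrier := M\<rparr>)"
    using h.hom_mult by (auto simp: iso_def hom_def bij_betw_def subset_iff)
  from Z_basis_iso_image[OF iso_set_trans[OF C(2) this]] C(1) show ?thesis by blast
qed


section \<open>Cohomology of permutation lattices\<close>

lemma cocycle_groupD:
  assumes "f \<in> carrier (cocycle_group G L act)"
  shows "g \<in> carrier G \<Longrightarrow> f g \<in> carrier L"
    and "\<lbrakk>g \<in> carrier G; h \<in> carrier G\<rbrakk> \<Longrightarrow> f (g \<otimes>\<^bsub>G\<^esub> h) = f g \<otimes>\<^bsub>L\<^esub> act g (f h)"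
    and "f \<in> extensional (carrier G)"
  using assms by (auto simp: cocycle_group_def PiE_def)

lemma cocycle_group_is_group:
  assumes "group G" "comm_group L" and hom: "\<And>g. g \<in> carrier G \<Longrightarrow> act g \<in> hom L L"
  shows "group (cocycle_group G L act)"
proof -
  interpret G: group G by fact
  interpret L: comm_group L by fact
  have act_closed: "act g x \<in> carrier L" if "g \<in> carrier G" "x \<in> carrier L" for g x
    using hom[OF that(1)] that(2) by (auto simp: hom_def)
  have act_hom: "act g (x \<otimes>\<^bsub>L\<^esub> y) = act g x \<otimes>\<^bsub>L\<^esub> act g y"
    if "g \<in> carrier G" "x \<in> carrier L" "y \<in> carrier L" for g x y
    using hom[OF that(1)] that(2,3) by (auto simp: hom_def)
  have act_group_hom: "group_hom L L (act g)" if "g \<in> carrier G" for g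
    using hom[OF that] by (simp add: group_hom_def group_hom_axioms_def L.is_group)
  show ?thesis
  proof (rule groupI)
    fix f f' assume f: "f \<in> carrier (cocycle_group G L act)" and f': "f' \<in> carrier (cocycle_group G L act)"
    note D = cocycle_groupD[OF f] cocycle_groupD[OF f']
    have "f (g \<otimes>\<^bsub>G\<^esub> h) \<otimes>\<^bsub>L\<^esub> f' (g \<otimes>\<^bsub>G\<^esub> h) = f g \<otimes>\<^bsub>L\<^esub> f' g \<otimes>\<^bsub>L\<^esub> act g (f h \<otimes>\<^bsub>L\<^esub> f' h)"
      if "g \<in> carrier G" "h \<in> carrier G" for g h
      using that by (simp add: D act_hom act_closed L.m_ac)
    then show "f \<otimes>\<^bsub>cocycle_group G L act\<^esub> f' \<in> carrier (cocycle_group G L act)"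
      by (auto simp: cocycle_group_def D)
  next
    show "\<one>\<^bsub>cocycle_group G L act\<^esub> \<in> carrier (cocycle_group G L act)"
      using group_hom.hom_one[OF act_group_hom] by (auto simp: cocycle_group_def)
  next
    fix f f' f'' assume f: "f \<in> carrier (cocycle_group G L act)"
      "f' \<in> carrier (cocycle_group G L act)" "f'' \<in> carrier (cocycle_group G L act)"
    then show "f \<otimes>\<^bsub>cocycle_group G L act\<^esub> f' \<otimes>\<^bsub>cocycle_group G L act\<^esub> f''
        = f \<otimes>\<^bsub>cocycle_group G L act\<^esub> (f' \<otimes>\<^bsub>cocycle_group G L act\<^esub> f'')"
      using cocycle_groupD(1)[OF f(1)] cocycle_groupD(1)[OF f(2)] cocycle_groupD(1)[OF f(3)]
      by (auto simp: cocycle_group_def L.m_assoc)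
  next
    fix f assume f: "f \<in> carrier (cocycle_group G L act)"
    then show "\<one>\<^bsub>cocycle_group G L act\<^esub> \<otimes>\<^bsub>cocycle_group G L act\<^esub> f = f"
      using cocycle_groupD[OF f] by (auto simp: cocycle_group_def extensional_def)
  next
    fix f assume f: "f \<in> carrier (cocycle_group G L act)"
    note D = cocycle_groupD[OF f]
    let ?f' = "\<lambda>g\<in>carrier G. inv\<^bsub>L\<^esub> f g"
    have "inv\<^bsub>L\<^esub> f (g \<otimes>\<^bsub>G\<^esub> h) = inv\<^bsub>L\<^esub> f g \<otimes>\<^bsub>L\<^esub> act g (inv\<^bsub>L\<^esub> f h)"
      if "g \<in> carrier G" "h \<in> carrier G" for g h
      using that by (simp add: D group_hom.hom_inv[OF act_group_hom] L.inv_mult act_closed)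
    then have "?f' \<in> carrier (cocycle_group G L act)"
      by (auto simp: cocycle_group_def D)
    moreover have "?f' \<otimes>\<^bsub>cocycle_group G L act\<^esub> f = \<one>\<^bsub>cocycle_group G L act\<^esub>"
      by (auto simp: cocycle_group_def D L.l_inv)
    ultimately show "\<exists>f'\<in>carrier (cocycle_group G L act).
        f' \<otimes>\<^bsub>cocycle_group G L act\<^esub> f = \<one>\<^bsub>cocycle_group G L act\<^esub>" by blast
  qed
qed

lemma coboundaries_subset_cocycles:
  assumes "group G" "comm_group L" and hom: "\<And>g. g \<in> carrier G \<Longrightarrow> act g \<in> hom L L"
    and act_mult: "\<And>g h x. \<lbrakk>g \<in> carrier G; h \<in> carrier G; x \<in> carrier L\<rbrakk>
                     \<Longrightarrow> act (g \<otimes>\<^bsub>G\<^esub> h) x = act g (act h x)"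
  shows "coboundaries G L act \<subseteq> carrier (cocycle_group G L act)"
proof
  interpret G: group G by fact
  interpret L: comm_group L by fact
  have act_closed: "act g x \<in> carrier L" if "g \<in> carrier G" "x \<in> carrier L" for g x
    using hom[OF that(1)] that(2) by (auto simp: hom_def)
  have act_hom: "act g (x \<otimes>\<^bsub>L\<^esub> y) = act g x \<otimes>\<^bsub>L\<^esub> act g y"
    if "g \<in> carrier G" "x \<in> carrier L" "y \<in> carrier L" for g x y
    using hom[OF that(1)] that(2,3) by (auto simp: hom_def)
  have act_group_hom: "group_hom L L (act g)" if "g \<in> carrier G" for g
    using hom[OF that] by (simp add: group_hom_def group_hom_axioms_def L.is_group)
  fix f assume "f \<in> coboundaries G L act"
  then obtain a where a: "a \<in> carrier L" and f: "f = (\<lambda>g\<in>carrier G. act g a \<otimes>\<^bsub>L\<^esub> inv\<^bsub>L\<^esub> a)"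
    by (auto simp: coboundaries_def)
  have "act (g \<otimes>\<^bsub>G\<^esub> h) a \<otimes>\<^bsub>L\<^esub> inv\<^bsub>L\<^esub> a
      = act g a \<otimes>\<^bsub>L\<^esub> inv\<^bsub>L\<^esub> a \<otimes>\<^bsub>L\<^esub> act g (act h a \<otimes>\<^bsub>L\<^esub> inv\<^bsub>L\<^esub> a)"
    if g: "g \<in> carrier G" and h: "h \<in> carrier G" for g h
  proof -
    let ?x = "act g a" and ?y = "act g (act h a)"
    have c: "?x \<in> carrier L" "?y \<in> carrier L" using g h a by (simp_all add: act_closed)
    have "?x \<otimes>\<^bsub>L\<^esub> (inv\<^bsub>L\<^esub> ?x \<otimes>\<^bsub>L\<^esub> ?y) = ?y" using c by (simp flip: L.m_assoc)
    then have "?x \<otimes>\<^bsub>L\<^esub> inv\<^bsub>L\<^esub> a \<otimes>\<^bsub>L\<^esub> (?y \<otimes>\<^bsub>L\<^esub> inv\<^bsub>L\<^esub> ?x) = ?y \<otimes>\<^bsub>L\<^esub> inv\<^bsub>L\<^esub> a"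
      using c a by (simp add: L.m_ac)
    then show ?thesis
      using g h a c by (simp add: act_mult act_hom act_closed group_hom.hom_inv[OF act_group_hom])
  qed
  then show "f \<in> carrier (cocycle_group G L act)"
    using a by (auto simp: cocycle_group_def f act_closed)
qed

lemma trivial_H1I:
  assumes "group G" "comm_group L" "\<And>g. g \<in> carrier G \<Longrightarrow> act g \<in> hom L L"
    and "\<And>g h x. \<lbrakk>g \<in> carrier G; h \<in> carrier G; x \<in> carrier L\<rbrakk>
                     \<Longrightarrow> act (g \<otimes>\<^bsub>G\<^esub> h) x = act g (act h x)"
    and cob: "\<And>f. f \<in> carrier (cocycle_group G L act) \<Longrightarrow>
               \<exists>a\<in>carrier L. \<forall>g\<in>carrier G. f g = act g a \<otimes>\<^bsub>L\<^esub> inv\<^bsub>L\<^esub> a"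
  shows "trivial_group (H1 G L act)"
proof -
  let ?Z = "cocycle_group G L act"
  interpret Z: group ?Z by (rule cocycle_group_is_group[OF assms(1-3)])
  have "carrier ?Z \<subseteq> coboundaries G L act"
  proof
    fix f assume f: "f \<in> carrier ?Z"
    from cob[OF f] obtain a where a: "a \<in> carrier L"
      and "\<forall>g\<in>carrier G. f g = act g a \<otimes>\<^bsub>L\<^esub> inv\<^bsub>L\<^esub> a" by blast
    then have "f = (\<lambda>g\<in>carrier G. act g a \<otimes>\<^bsub>L\<^esub> inv\<^bsub>L\<^esub> a)"
      using cocycle_groupD(3)[OF f] by (auto simp: extensional_def)
    then show "f \<in> coboundaries G L act" using a by (auto simp: coboundaries_def)
  qed
  then have eq: "coboundaries G L act = carrier ?Z"
    using coboundaries_subset_cocycles[OF assms(1-4)] by blast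
  have "carrier (?Z Mod carrier ?Z) = {carrier ?Z}"
    using Z.coset_join2[OF _ Z.subgroup_self] Z.one_closed by (auto simp: FactGroup_def RCOSETS_def)
  then show ?thesis
    using normal.factorgroup_is_group[OF Z.normal_self]
    by (simp add: H1_def eq trivial_group_def FactGroup_def)
qed

text \<open>Summing the cocycle identity over the group gives \<open>N F(g) = S - g S\<close> with
  \<open>S = \<Sum> F(k)\<close> and \<open>N\<close> the group order. Over the rationals \<open>-S / N\<close> would be a primitive. Because
  \<open>G\<close> only permutes the coordinates, and \<open>S\<close> is \<open>G\<close>-invariant modulo \<open>N\<close>, rounding each coordinate
  of \<open>S / N\<close> down removes a \<open>G\<close>-invariant vector and leaves an integral primitive.\<close>

lemma permutation_cocycle_is_coboundary:
  fixes F :: "'g \<Rightarrow> ('b \<Rightarrow>\<^sub>0 int)"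
  assumes "group G" "finite (carrier G)"
    and bij: "\<And>g. g \<in> carrier G \<Longrightarrow> bij_betw (\<alpha> g) B B"
    and keys: "\<And>g. g \<in> carrier G \<Longrightarrow> Poly_Mapping.keys (F g) \<subseteq> B"
    and coc: "\<And>g h. \<lbrakk>g \<in> carrier G; h \<in> carrier G\<rbrakk> \<Longrightarrow> F (g \<otimes>\<^bsub>G\<^esub> h) = F g + frag_map (\<alpha> g) (F h)"
  shows "\<exists>a. Poly_Mapping.keys a \<subseteq> B \<and> (\<forall>g\<in>carrier G. F g = frag_map (\<alpha> g) a - a)"
proof -
  interpret G: group G by fact
  define N where "N = int (card (carrier G))"
  have N: "N > 0" using assms(2) G.one_closed by (auto simp: N_def card_gt_0_iff)
  define S where "S = (\<Sum>k\<in>carrier G. F k)"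
  have keysS: "Poly_Mapping.keys S \<subseteq> B"
    unfolding S_def using keys_sum[of F "carrier G"] keys by blast
  have lookupS: "Poly_Mapping.lookup S (\<alpha> g b) = N * Poly_Mapping.lookup (F g) (\<alpha> g b) + Poly_Mapping.lookup S b"
    if g: "g \<in> carrier G" and b: "b \<in> B" for g b
  proof -
    have lookup_sum_const: "Poly_Mapping.lookup (\<Sum>k\<in>carrier G. F g) c = N * Poly_Mapping.lookup (F g) c" for c
      by (simp add: lookup_sum N_def)
    have "S = (\<Sum>k\<in>carrier G. F (g \<otimes>\<^bsub>G\<^esub> k))"
      unfolding S_def
      by (rule sum.reindex_bij_witness[where i = "\<lambda>k. g \<otimes>\<^bsub>G\<^esub> k" and j = "\<lambda>k. inv\<^bsub>G\<^esub> g \<otimes>\<^bsub>G\<^esub> k"])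
        (use g in \<open>auto simp: G.m_assoc[symmetric]\<close>)
    also have "\<dots> = (\<Sum>k\<in>carrier G. F g) + frag_map (\<alpha> g) S"
      using g by (simp add: coc sum.distrib frag_map_sum S_def)
    finally have "S = (\<Sum>k\<in>carrier G. F g) + frag_map (\<alpha> g) S" .
    from arg_cong[OF this, of "\<lambda>x. Poly_Mapping.lookup x (\<alpha> g b)"]
    have "Poly_Mapping.lookup S (\<alpha> g b)
        = N * Poly_Mapping.lookup (F g) (\<alpha> g b) + Poly_Mapping.lookup (frag_map (\<alpha> g) S) (\<alpha> g b)"
      by (simp only: lookup_add lookup_sum_const)
    then show ?thesis
      using lookup_frag_map[OF bij_betw_imp_inj_on[OF bij[OF g]] keysS b] by simp
  qed
  define a where "a = Poly_Mapping.map (\<lambda>c. - (c div N)) S"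
  have lookupa: "Poly_Mapping.lookup a b = - (Poly_Mapping.lookup S b div N)" for b
    by (simp add: a_def Poly_Mapping.map.rep_eq when_def)
  have keysa: "Poly_Mapping.keys a \<subseteq> B"
  proof
    fix b assume "b \<in> Poly_Mapping.keys a"
    then have "Poly_Mapping.lookup S b \<noteq> 0" by (auto simp: in_keys_iff lookupa)
    then show "b \<in> B" using keysS by (auto simp: in_keys_iff)
  qed
  have "F g = frag_map (\<alpha> g) a - a" if g: "g \<in> carrier G" for g
  proof (rule poly_mapping_eqI)
    fix c
    show "Poly_Mapping.lookup (F g) c = Poly_Mapping.lookup (frag_map (\<alpha> g) a - a) c"
    proof (cases "c \<in> B")
      case True
      then obtain b where b: "b \<in> B" and c: "c = \<alpha> g b"
        using bij_betw_imp_surj_on[OF bij[OF g]] by blast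
      show ?thesis
        using lookup_frag_map[OF bij_betw_imp_inj_on[OF bij[OF g]] keysa b] N
        by (simp add: c lookup_minus lookupa lookupS[OF g b])
    next
      case False
      have "Poly_Mapping.keys (frag_map (\<alpha> g) a) \<subseteq> B"
        using keys_frag_map[of "\<alpha> g" a] keysa bij_betw_imp_surj_on[OF bij[OF g]] by blast
      then have "c \<notin> Poly_Mapping.keys (frag_map (\<alpha> g) a)" "c \<notin> Poly_Mapping.keys a"
        "c \<notin> Poly_Mapping.keys (F g)"
        using False keysa keys[OF g] by blast+
      then have "Poly_Mapping.lookup (frag_map (\<alpha> g) a) c = 0" "Poly_Mapping.lookup a c = 0"
        "Poly_Mapping.lookup (F g) c = 0"
        by (simp_all only: in_keys_iff not_not)
      then show ?thesis by (simp add: lookup_minus)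
    qed
  qed
  then show ?thesis using keysa by blast
qed

lemma hom_free_Abelian_group_eqI:
  assumes "group L" "f \<in> hom (free_Abelian_group B) L" "f' \<in> hom (free_Abelian_group B) L"
    and x: "Poly_Mapping.keys x \<subseteq> B"
    and eq: "\<And>b. b \<in> B \<Longrightarrow> f (frag_of b) = f' (frag_of b)"
  shows "f x = f' x"
proof -
  interpret L: group L by fact
  interpret f: group_hom "free_Abelian_group B" L f
    using assms by (simp add: group_hom_def group_hom_axioms_def)
  interpret f': group_hom "free_Abelian_group B" L f'
    using assms by (simp add: group_hom_def group_hom_axioms_def)
  show ?thesis
  proof (rule free_Abelian_group_induct[OF x, where P = "\<lambda>x. f x = f' x"])
    show "f 0 = f' 0" using f.hom_one f'.hom_one by simp
    show "f (y - z) = f' (y - z)"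
      if "Poly_Mapping.keys y \<subseteq> B" "Poly_Mapping.keys z \<subseteq> B" "f y = f' y" "f z = f' z" for y z
      using that f.hom_mult[of y "- z"] f'.hom_mult[of y "- z"] f.hom_inv[of z] f'.hom_inv[of z]
      by simp
  qed (rule eq)
qed

lemma permutation_lattice_cocycle_is_coboundary:
  assumes perm: "permutation_lattice G P act" and H: "subgroup H G" "finite H"
    and fP: "\<And>g. g \<in> H \<Longrightarrow> f g \<in> carrier P"
    and coc: "\<And>g h. \<lbrakk>g \<in> H; h \<in> H\<rbrakk> \<Longrightarrow> f (g \<otimes>\<^bsub>G\<^esub> h) = f g \<otimes>\<^bsub>P\<^esub> act g (f h)"
  shows "\<exists>a\<in>carrier P. \<forall>g\<in>H. f g = act g a \<otimes>\<^bsub>P\<^esub> inv\<^bsub>P\<^esub> a"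
proof -
  from perm obtain B where "G_lattice G P act" and B: "Z_basis P B"
    and stable: "\<And>g. g \<in> carrier G \<Longrightarrow> act g ` B \<subseteq> B"
    by (auto simp: permutation_lattice_def)
  interpret P: G_lattice G P act by fact
  interpret H: subgroup H G by fact
  have BP: "B \<subseteq> carrier P" using B by (simp add: Z_basis_def)
  let ?F = "free_Abelian_group B"
  obtain \<phi> where \<phi>: "\<phi> \<in> iso ?F P" and \<phi>B: "\<And>b. b \<in> B \<Longrightarrow> \<phi> (frag_of b) = b"
    using B by (auto simp: Z_basis_def)
  interpret \<phi>: group_hom ?F P \<phi>
    using \<phi> by (simp add: group_hom_def group_hom_axioms_def iso_def P.L.is_group)
  have bij: "bij_betw (act g) B B" if g: "g \<in> carrier G" for g
  proof (rule bij_betw_byWitness[where f' = "act (inv\<^bsub>G\<^esub> g)"])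
    show "\<forall>b\<in>B. act (inv\<^bsub>G\<^esub> g) (act g b) = b" "\<forall>b\<in>B. act g (act (inv\<^bsub>G\<^esub> g) b) = b"
      using g BP by (auto simp: P.act_mult[symmetric] P.act_one)
  qed (use g stable in auto)
  have equiv: "\<phi> (frag_map (act g) x) = act g (\<phi> x)"
    if g: "g \<in> carrier G" and x: "Poly_Mapping.keys x \<subseteq> B" for g x
  proof (rule hom_free_Abelian_group_eqI[OF P.L.is_group _ _ x])
    have "frag_map (act g) \<in> hom ?F ?F"
      using iso_frag_map[OF bij[OF g]] by (simp add: iso_def)
    from hom_compose[OF this \<phi>.homh] show "(\<lambda>x. \<phi> (frag_map (act g) x)) \<in> hom ?F P"
      by (simp add: comp_def)
    from hom_compose[OF \<phi>.homh P.act_hom[OF g]] show "(\<lambda>x. act g (\<phi> x)) \<in> hom ?F P"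
      by (simp add: comp_def)
    show "\<phi> (frag_map (act g) (frag_of b)) = act g (\<phi> (frag_of b))" if "b \<in> B" for b
      using that stable[OF g] by (simp add: image_subset_iff \<phi>B)
  qed
  have inj: "inj_on \<phi> (carrier ?F)" and onto: "\<phi> ` carrier ?F = carrier P"
    using \<phi> by (auto simp: iso_def bij_betw_def)
  define F where "F g = inv_into (carrier ?F) \<phi> (f g)" for g
  have F: "Poly_Mapping.keys (F g) \<subseteq> B" "\<phi> (F g) = f g" if "g \<in> H" for g
  proof -
    have "f g \<in> \<phi> ` carrier ?F" using fP[OF that] onto by blast
    then have "F g \<in> carrier ?F" "\<phi> (F g) = f g"
      unfolding F_def by (rule inv_into_into, rule f_inv_into_f)
    then show "Poly_Mapping.keys (F g) \<subseteq> B" "\<phi> (F g) = f g" by simp_all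
  qed
  have keys_act: "Poly_Mapping.keys (frag_map (act g) x) \<subseteq> B"
    if "g \<in> carrier G" "Poly_Mapping.keys x \<subseteq> B" for g x
    using keys_frag_map[of "act g" x] that stable[OF that(1)] by blast
  have "\<exists>a. Poly_Mapping.keys a \<subseteq> B
    \<and> (\<forall>g\<in>carrier (G\<lparr>carrier := H\<rparr>). F g = frag_map (act g) a - a)"
  proof (rule permutation_cocycle_is_coboundary)
    show "group (G\<lparr>carrier := H\<rparr>)" using H(1) by (rule P.G.subgroup_imp_group)
    fix g h assume "g \<in> carrier (G\<lparr>carrier := H\<rparr>)" "h \<in> carrier (G\<lparr>carrier := H\<rparr>)"
    then have g: "g \<in> H" "g \<in> carrier G" and h: "h \<in> H" "h \<in> carrier G" by auto
    have k: "Poly_Mapping.keys (F g + frag_map (act g) (F h)) \<subseteq> B"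
      using keys_add[of "F g" "frag_map (act g) (F h)"] F(1)[OF g(1)] keys_act[OF g(2) F(1)[OF h(1)]]
      by blast
    have "\<phi> (F (g \<otimes>\<^bsub>G\<^esub> h)) = \<phi> (F g) \<otimes>\<^bsub>P\<^esub> \<phi> (frag_map (act g) (F h))"
      using g h F H.m_closed[OF g(1) h(1)] by (simp add: coc equiv)
    also have "\<dots> = \<phi> (F g + frag_map (act g) (F h))"
      using \<phi>.hom_mult[of "F g" "frag_map (act g) (F h)"] F(1)[OF g(1)] keys_act[OF g(2) F(1)[OF h(1)]]
      by simp
    finally show "F (g \<otimes>\<^bsub>G\<lparr>carrier := H\<rparr>\<^esub> h) = F g + frag_map (act g) (F h)"
      using inj_onD[OF inj] F(1)[OF H.m_closed[OF g(1) h(1)]] k by simp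
  qed (use H(2) bij F in auto)
  then obtain a where a: "Poly_Mapping.keys a \<subseteq> B"
    and Fa: "\<And>g. g \<in> H \<Longrightarrow> F g = frag_map (act g) a - a" by auto
  have "f g = act g (\<phi> a) \<otimes>\<^bsub>P\<^esub> inv\<^bsub>P\<^esub> \<phi> a" if g: "g \<in> H" for g
  proof -
    have "f g = \<phi> (frag_map (act g) a - a)" using F(2)[OF g] Fa[OF g] by simp
    also have "\<dots> = \<phi> (frag_map (act g) a) \<otimes>\<^bsub>P\<^esub> \<phi> (- a)"
      using \<phi>.hom_mult[of "frag_map (act g) a" "- a"] keys_act[OF _ a, of g] g a by simp
    also have "\<phi> (- a) = inv\<^bsub>P\<^esub> \<phi> a"
      using \<phi>.hom_inv[of a] a by simp
    finally show ?thesis using equiv[OF _ a, of g] g by simp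
  qed
  moreover have "\<phi> a \<in> carrier P" using a \<phi>.hom_closed by simp
  ultimately show ?thesis by blast
qed

text \<open>The connecting map of the long exact sequence, in cochains: a cocycle with values in the
  kernel is the coboundary of some \<open>a \<in> P\<close>, so \<open>\<pi> a\<close> is fixed by \<open>H\<close>; subtracting from \<open>a\<close> an
  \<open>H\<close>-fixed preimage of \<open>\<pi> a\<close> gives a primitive in the kernel. Asking for a preimage with at
  least the stabiliser of the given point serves all subgroups \<open>H\<close> at once.\<close>

theorem coflasque_resolution_kernelI:
  assumes perm: "permutation_lattice G P actP" and fin: "finite (carrier G)"
    and N: "G_lattice G N actN"
    and \<pi>: "\<pi> \<in> hom P N" and equiv: "equivariant G P actP actN \<pi>"
    and lift: "\<And>x. x \<in> carrier N \<Longrightarrow>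
      \<exists>y\<in>carrier P. \<pi> y = x \<and> (\<forall>g\<in>carrier G. actN g x = x \<longrightarrow> actP g y = y)"
  shows "coflasque_resolution G (P\<lparr>carrier := kernel P N \<pi>\<rparr>) actP P actP N actN (\<lambda>x. x) \<pi>"
proof -
  interpret N: G_lattice G N actN by fact
  from perm obtain B where "G_lattice G P actP" and B: "finite B" "Z_basis P B"
    by (auto simp: permutation_lattice_def)
  interpret P: G_lattice G P actP by fact
  interpret \<pi>: group_hom P N \<pi>
    using \<pi> by (simp add: group_hom_def group_hom_axioms_def P.L.is_group N.L.is_group)
  let ?K = "kernel P N \<pi>"
  let ?F = "P\<lparr>carrier := ?K\<rparr>"
  have K: "subgroup ?K P" by (rule \<pi>.subgroup_kernel)
  have K_iff: "x \<in> ?K \<longleftrightarrow> x \<in> carrier P \<and> \<pi> x = \<one>\<^bsub>N\<^esub>" for x by (simp add: kernel_def)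
  have \<pi>_act: "\<pi> (actP g x) = actN g (\<pi> x)" if "g \<in> carrier G" "x \<in> carrier P" for g x
    using equiv that by (simp add: equivariant_def)
  have actP_closed: "actP g x \<in> carrier P" if "g \<in> carrier G" "x \<in> carrier P" for g x
    using P.act_hom[OF that(1)] that(2) by (auto simp: hom_def)
  have actN_hom: "group_hom N N (actN g)" if "g \<in> carrier G" for g
    using N.act_hom[OF that] by (simp add: group_hom_def group_hom_axioms_def N.L.is_group)
  have actP_hom: "group_hom P P (actP g)" if "g \<in> carrier G" for g
    using P.act_hom[OF that] by (simp add: group_hom_def group_hom_axioms_def P.L.is_group)
  have actK: "actP g x \<in> ?K" if "g \<in> carrier G" "x \<in> ?K" for g x
    using that group_hom.hom_one[OF actN_hom] by (simp add: K_iff actP_closed \<pi>_act)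
  have act_homK: "actP g \<in> hom ?F ?F" if "g \<in> carrier G" for g
    using group_hom.hom_mult[OF actP_hom[OF that]] actK[OF that]
    by (auto simp: hom_def K_iff)
  have comm: "comm_group ?F"
    using P.L.subgroup_imp_group[OF K]
    by (rule group.group_comm_groupI) (auto simp: K_iff P.L.m_comm)
  have lattice: "G_lattice G ?F actP"
  proof (intro G_lattice.intro G_lattice_axioms.intro)
    show "\<exists>B. finite B \<and> Z_basis ?F B" by (rule subgroup_Z_basis[OF P.L.is_group B K])
  qed (use P.act_one P.act_mult act_homK comm N.G.group_axioms in \<open>auto simp: K_iff\<close>)
  have H1: "trivial_group (H1 (G\<lparr>carrier := H\<rparr>) ?F actP)" if H: "subgroup H G" for H
  proof (rule trivial_H1I)
    interpret H: subgroup H G by fact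
    show "group (G\<lparr>carrier := H\<rparr>)" using H by (rule N.G.subgroup_imp_group)
    show "comm_group ?F" by (fact comm)
    show "actP g \<in> hom ?F ?F" if "g \<in> carrier (G\<lparr>carrier := H\<rparr>)" for g
      using act_homK that by simp
    show "actP (g \<otimes>\<^bsub>G\<lparr>carrier := H\<rparr>\<^esub> h) x = actP g (actP h x)"
      if "g \<in> carrier (G\<lparr>carrier := H\<rparr>)" "h \<in> carrier (G\<lparr>carrier := H\<rparr>)" "x \<in> carrier ?F" for g h x
      using that P.act_mult by (simp add: K_iff)
    fix f assume f: "f \<in> carrier (cocycle_group (G\<lparr>carrier := H\<rparr>) ?F actP)"
    note D = cocycle_groupD[OF f, simplified]
    have "\<exists>a\<in>carrier P. \<forall>g\<in>H. f g = actP g a \<otimes>\<^bsub>P\<^esub> inv\<^bsub>P\<^esub> a"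
      by (rule permutation_lattice_cocycle_is_coboundary[OF perm H])
         (use finite_subset[OF H.subset fin] D in \<open>auto simp: K_iff\<close>)
    then obtain a where a: "a \<in> carrier P" and fa: "\<And>g. g \<in> H \<Longrightarrow> f g = actP g a \<otimes>\<^bsub>P\<^esub> inv\<^bsub>P\<^esub> a"
      by blast
    obtain b where b: "b \<in> carrier P" "\<pi> b = \<pi> a"
      and fixb: "\<And>g. \<lbrakk>g \<in> carrier G; actN g (\<pi> a) = \<pi> a\<rbrakk> \<Longrightarrow> actP g b = b"
      using lift[OF \<pi>.hom_closed[OF a]] by blast
    \<comment> \<open>The values of \<open>f\<close> are in the kernel, so \<open>\<pi> a\<close> is fixed by \<open>H\<close>.\<close>
    have fixes_b: "actP g b = b" if g: "g \<in> H" for g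
    proof (rule fixb)
      show gG: "g \<in> carrier G" using g by simp
      have "\<one>\<^bsub>N\<^esub> = actN g (\<pi> a) \<otimes>\<^bsub>N\<^esub> inv\<^bsub>N\<^esub> \<pi> a"
        using D(1)[OF g] fa[OF g] a gG by (simp add: K_iff \<pi>_act actP_closed)
      then show "actN g (\<pi> a) = \<pi> a"
        using N.L.inv_solve_right[of "\<one>\<^bsub>N\<^esub>" "actN g (\<pi> a)" "\<pi> a"] a
          group_hom.hom_closed[OF actN_hom[OF gG]] by simp
    qed
    let ?c = "a \<otimes>\<^bsub>P\<^esub> inv\<^bsub>P\<^esub> b"
    have c: "?c \<in> ?K" using a b by (simp add: K_iff)
    have "f g = actP g ?c \<otimes>\<^bsub>P\<^esub> inv\<^bsub>P\<^esub> ?c" if g: "g \<in> H" for g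
    proof -
      have gG: "g \<in> carrier G" using g by simp
      have x: "actP g a \<in> carrier P" using gG a by (rule actP_closed)
      have "actP g ?c = actP g a \<otimes>\<^bsub>P\<^esub> inv\<^bsub>P\<^esub> b"
        using a b fixes_b[OF g] group_hom.hom_mult[OF actP_hom[OF gG]] group_hom.hom_inv[OF actP_hom[OF gG]]
        by simp
      moreover have "inv\<^bsub>P\<^esub> ?c = inv\<^bsub>P\<^esub> a \<otimes>\<^bsub>P\<^esub> b"
        using a b by (simp add: P.L.inv_mult)
      moreover have "actP g a \<otimes>\<^bsub>P\<^esub> inv\<^bsub>P\<^esub> b \<otimes>\<^bsub>P\<^esub> (inv\<^bsub>P\<^esub> a \<otimes>\<^bsub>P\<^esub> b)
          = actP g a \<otimes>\<^bsub>P\<^esub> inv\<^bsub>P\<^esub> a"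
      proof -
        have "b \<otimes>\<^bsub>P\<^esub> (inv\<^bsub>P\<^esub> b \<otimes>\<^bsub>P\<^esub> (inv\<^bsub>P\<^esub> a \<otimes>\<^bsub>P\<^esub> actP g a)) = inv\<^bsub>P\<^esub> a \<otimes>\<^bsub>P\<^esub> actP g a"
          using a b x by (simp flip: P.L.m_assoc)
        then show ?thesis using a b x by (simp add: P.L.m_ac)
      qed
      ultimately show ?thesis using a b x fa[OF g] by simp
    qed
    then show "\<exists>a\<in>carrier ?F. \<forall>g\<in>carrier (G\<lparr>carrier := H\<rparr>). f g = actP g a \<otimes>\<^bsub>?F\<^esub> inv\<^bsub>?F\<^esub> a"
      using c P.L.m_inv_consistent[OF K c] by (intro bexI[of _ ?c]) auto
  qed
  have "\<pi> ` carrier P = carrier N"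
    using lift \<pi>.hom_closed by (auto simp: image_iff)
  moreover have "(\<lambda>x. x) \<in> mon ?F P" by (auto simp: mon_def hom_def K_iff)
  ultimately show ?thesis
    using lattice H1 perm N \<pi> equiv
    by (auto simp: coflasque_resolution_def coflasque_def epi_def equivariant_def)
qed


section \<open>The lattices of the resolution\<close>

lemma comm_group_free_product:
  "comm_group (free_Abelian_group A \<times>\<times> sum_group I (\<lambda>i. free_Abelian_group (B i)))"
proof (rule group.group_comm_groupI)
  show "group (free_Abelian_group A \<times>\<times> sum_group I (\<lambda>i. free_Abelian_group (B i)))"
    by (simp add: DirProd_group)
qed (auto simp: DirProd_def add.commute)

text \<open>With finitely many summands, the finite-support condition of \<open>sum_group\<close> is void and only
  extensionality remains.\<close>

lemma mem_free_product_iff: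
  assumes "finite I"
  shows "(x, z) \<in> carrier (free_Abelian_group A \<times>\<times> sum_group I (\<lambda>i. free_Abelian_group (B i)))
    \<longleftrightarrow> Poly_Mapping.keys x \<subseteq> A \<and> z \<in> extensional I \<and> (\<forall>i\<in>I. Poly_Mapping.keys (z i) \<subseteq> B i)"
  using assms by (auto simp: DirProd_def carrier_sum_group PiE_def Pi_def)

text \<open>The canonical map from \<open>\<int>[A <+> Sigma I B]\<close> to the direct sum of its parts, extended by zero
  to the terms with an index outside \<open>I\<close>.\<close>

definition free_product_map ::
    "'i set \<Rightarrow> ('a + 'i \<times> 'b \<Rightarrow>\<^sub>0 int) \<Rightarrow> ('a \<Rightarrow>\<^sub>0 int) \<times> ('i \<Rightarrow> 'b \<Rightarrow>\<^sub>0 int)" where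
  "free_product_map I y =
     (frag_extend (case_sum frag_of (\<lambda>_. 0)) y,
      \<lambda>i\<in>I. frag_extend (case_sum (\<lambda>_. 0) (\<lambda>(j, b). if j = i then frag_of b else 0)) y)"

lemma free_product_map_frag_of [simp]:
  "free_product_map I (frag_of (Inl a)) = (frag_of a, \<lambda>i\<in>I. 0)"
  "free_product_map I (frag_of (Inr (j, b))) = (0, \<lambda>i\<in>I. if j = i then frag_of b else 0)"
  by (auto simp: free_product_map_def)

lemma iso_free_product_map:
  fixes A :: "'a set" and I :: "'i set" and B :: "'i \<Rightarrow> 'b set"
  assumes "finite I"
  defines "S \<equiv> A <+> Sigma I B"
  shows "free_product_map I \<in> iso (free_Abelian_group S)
           (free_Abelian_group A \<times>\<times> sum_group I (\<lambda>i. free_Abelian_group (B i)))"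
proof -
  let ?L = "free_Abelian_group A \<times>\<times> sum_group I (\<lambda>i. free_Abelian_group (B i))"
  define \<psi> where "\<psi> = (\<lambda>(x :: 'a \<Rightarrow>\<^sub>0 int, z :: 'i \<Rightarrow> 'b \<Rightarrow>\<^sub>0 int).
    frag_map Inl x + (\<Sum>i\<in>I. frag_map (\<lambda>b. Inr (i, b)) (z i)))"
  have closed: "free_product_map I y \<in> carrier ?L" if y: "Poly_Mapping.keys y \<subseteq> S" for y
  proof -
    have "Poly_Mapping.keys (frag_extend (case_sum frag_of (\<lambda>_. 0)) y) \<subseteq> A"
      by (rule order.trans[OF keys_frag_extend]) (use y in \<open>auto simp: S_def\<close>)
    moreover have "Poly_Mapping.keys (frag_extend
        (case_sum (\<lambda>_. 0) (\<lambda>(j, b). if j = i then frag_of b else 0)) y) \<subseteq> B i" if "i \<in> I" for i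
      by (rule order.trans[OF keys_frag_extend]) (use y in \<open>auto simp: S_def split: if_splits\<close>)
    ultimately show ?thesis
      unfolding free_product_map_def mem_free_product_iff[OF assms(1)] by simp
  qed
  have hom: "free_product_map I \<in> hom (free_Abelian_group S) ?L"
    using closed by (intro homI) (auto simp: free_product_map_def DirProd_def frag_extend_add)
  have \<psi>_closed: "Poly_Mapping.keys (\<psi> (x, z)) \<subseteq> S" if "(x, z) \<in> carrier ?L" for x z
  proof -
    have xz: "Poly_Mapping.keys x \<subseteq> A" "\<And>i. i \<in> I \<Longrightarrow> Poly_Mapping.keys (z i) \<subseteq> B i"
      using that unfolding mem_free_product_iff[OF assms(1)] by blast+
    have "Poly_Mapping.keys (frag_map Inl x) \<subseteq> S"
      using keys_frag_map[of Inl x] xz(1) by (auto simp: S_def)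
    moreover have "Poly_Mapping.keys (\<Sum>i\<in>I. frag_map (\<lambda>b. Inr (i, b)) (z i)) \<subseteq> S"
    proof (rule order.trans[OF keys_sum UN_least])
      fix i assume "i \<in> I"
      then show "Poly_Mapping.keys (frag_map (\<lambda>b. Inr (i, b)) (z i)) \<subseteq> S"
        using keys_frag_map[of "\<lambda>b. Inr (i, b)" "z i"] xz(2)[of i] by (fastforce simp: S_def)
    qed
    ultimately show ?thesis
      unfolding \<psi>_def by (simp add: order.trans[OF keys_add])
  qed
  have "bij_betw (free_product_map I) (carrier (free_Abelian_group S)) (carrier ?L)"
  proof (rule bij_betw_byWitness[where f' = \<psi>])
    show "\<forall>y\<in>carrier (free_Abelian_group S). \<psi> (free_product_map I y) = y"
    proof
      fix y assume "y \<in> carrier (free_Abelian_group S)"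
      then have "Poly_Mapping.keys y \<subseteq> S" by simp
      then show "\<psi> (free_product_map I y) = y"
      proof (induction y rule: frag_induction)
        case zero
        show ?case by (simp add: \<psi>_def free_product_map_def)
      next
        case (one s)
        have "(\<Sum>i\<in>I. frag_map (\<lambda>b. Inr (i, b)) (if j = i then frag_of b else 0))
            = (if j \<in> I then frag_of (Inr (j, b)) else 0 :: 'a + 'i \<times> 'b \<Rightarrow>\<^sub>0 int)" for j b
        proof -
          have "(\<Sum>i\<in>I. frag_map (\<lambda>b. Inr (i, b)) (if j = i then frag_of b else 0))
              = (\<Sum>i\<in>I. if j = i then frag_of (Inr (j, b)) else 0 :: 'a + 'i \<times> 'b \<Rightarrow>\<^sub>0 int)"
            by (rule sum.cong) auto
          then show ?thesis using assms(1) by simp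
        qed
        then show ?case using one by (auto simp: \<psi>_def S_def cong: sum.cong)
      next
        case (diff x y)
        have "\<psi> (free_product_map I (x - y)) = \<psi> (free_product_map I x) - \<psi> (free_product_map I y)"
          by (simp add: \<psi>_def free_product_map_def frag_map_def frag_extend_diff sum_subtractf
              cong: sum.cong)
        with diff show ?case by simp
      qed
    qed
    show "\<forall>u\<in>carrier ?L. free_product_map I (\<psi> u) = u"
    proof
      fix u assume u: "u \<in> carrier ?L"
      obtain x z where xz: "u = (x, z)" by (cases u)
      have z: "z \<in> extensional I" using u unfolding xz mem_free_product_iff[OF assms(1)] by blast
      have "frag_extend (case_sum frag_of (\<lambda>_. 0)) (\<psi> (x, z)) = x"
        using assms(1)
        by (simp add: \<psi>_def frag_extend_add frag_extend_sum frag_extend_frag_map comp_def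
            frag_extend_eq_0 flip: frag_expansion)
      moreover have "frag_extend (case_sum (\<lambda>_. 0) (\<lambda>(j, b). if j = i then frag_of b else 0))
          (\<psi> (x, z)) = z i" if i: "i \<in> I" for i
      proof -
        have "frag_extend (case_sum (\<lambda>_. 0) (\<lambda>(j, b). if j = i then frag_of b else 0)) (\<psi> (x, z))
            = (\<Sum>j\<in>I. frag_extend (\<lambda>b. if j = i then frag_of b else 0) (z j))"
          using assms(1)
          by (simp add: \<psi>_def frag_extend_add frag_extend_sum frag_extend_frag_map comp_def
              frag_extend_eq_0)
        also have "\<dots> = (\<Sum>j\<in>I. if j = i then z i else 0)"
          by (rule sum.cong) (auto simp: frag_extend_eq_0 simp flip: frag_expansion)
        finally show ?thesis using assms(1) i by simp
      qed
      ultimately show "free_product_map I (\<psi> u) = u"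
        using z by (auto simp: xz free_product_map_def extensional_def)
    qed
    show "free_product_map I ` carrier (free_Abelian_group S) \<subseteq> carrier ?L"
      by (intro image_subsetI closed) simp
    show "\<psi> ` carrier ?L \<subseteq> carrier (free_Abelian_group S)"
    proof (rule image_subsetI)
      fix u assume "u \<in> carrier ?L"
      then show "\<psi> u \<in> carrier (free_Abelian_group S)"
        using \<psi>_closed[of "fst u" "snd u"] by simp
    qed
  qed
  with hom show ?thesis by (simp add: iso_def)
qed


lemma finite_prime_divs: "n \<ge> 2 \<Longrightarrow> finite (prime_divs n)"
  by (rule finite_subset[of _ "{..n}"]) (auto simp: prime_divs_def dest: dvd_imp_le)

lemma finite_Q0_basis: "finite (Q0_basis n)"
proof (rule finite_subset)
  show "Q0_basis n \<subseteq> {1..n} \<times> {1..n}" unfolding Q0_basis_def by blast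
qed simp

lemma finite_Qp_basis: "finite (Qp_basis n p)"
proof (rule finite_subset)
  show "Qp_basis n p \<subseteq> Pow {1..n} \<times> Pow {1..n}" unfolding Qp_basis_def by blast
qed simp

lemma permutes_Q0_basis:
  assumes "\<sigma> permutes {1..n}" "b \<in> Q0_basis n"
  shows "map_prod \<sigma> \<sigma> b \<in> Q0_basis n"
  using assms(2)
  by (cases b)
     (simp add: Q0_basis_def permutes_in_image[OF assms(1)] inj_eq[OF permutes_inj[OF assms(1)]]
       del: atLeastAtMost_iff One_nat_def)

lemma permutes_Qp_basis:
  assumes \<sigma>: "\<sigma> permutes {1..n}" and b: "b \<in> Qp_basis n p"
  shows "map_prod (image \<sigma>) (image \<sigma>) b \<in> Qp_basis n p"
proof -
  have inj: "inj \<sigma>" using \<sigma> by (rule permutes_inj)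
  have sub: "\<sigma> ` I \<subseteq> {1..n}" if "I \<subseteq> {1..n}" for I
    using image_mono[OF that, of \<sigma>] unfolding permutes_image[OF \<sigma>] .
  have card: "card (\<sigma> ` I) = card I" for I
    using inj by (intro card_image inj_on_subset[OF inj]) simp
  obtain I J where "b = (I, J)" by (cases b)
  with b show ?thesis
    by (auto simp: Qp_basis_def sub card image_Int[OF inj, symmetric] simp del: atLeastAtMost_iff One_nat_def)
qed

lemma linear_perm_Q: "Q0_act \<sigma> = frag_map (map_prod \<sigma> \<sigma>)"
    "Qp_act \<sigma> = frag_map (map_prod (image \<sigma>) (image \<sigma>))" "root_act \<sigma> = frag_map \<sigma>"
  by (simp_all add: Q0_act_def Qp_act_def root_act_def linear_perm_eq_frag_map map_prod_def)

lemma Q_sum_eq: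
  "Q_sum n = free_Abelian_group (Q0_basis n)
     \<times>\<times> sum_group (prime_divs n) (\<lambda>p. free_Abelian_group (Qp_basis n p))"
  by (simp add: Q_sum_def Q0_def Qp_def[abs_def])

lemma mem_Q_sum_iff:
  assumes "n \<ge> 2"
  shows "(x, z) \<in> carrier (Q_sum n) \<longleftrightarrow> Poly_Mapping.keys x \<subseteq> Q0_basis n \<and>
    z \<in> extensional (prime_divs n) \<and> (\<forall>p\<in>prime_divs n. Poly_Mapping.keys (z p) \<subseteq> Qp_basis n p)"
  unfolding Q_sum_eq by (rule mem_free_product_iff[OF finite_prime_divs[OF assms]])

lemma mult_Q_sum: "(x, z) \<otimes>\<^bsub>Q_sum n\<^esub> (x', z') = (x + x', \<lambda>p\<in>prime_divs n. z p + z' p)"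
  by (simp add: Q_sum_eq DirProd_def)

lemma Q_act_closed:
  assumes "n \<ge> 2" "\<sigma> permutes {1..n}" "q \<in> carrier (Q_sum n)"
  shows "Q_act n \<sigma> q \<in> carrier (Q_sum n)"
proof -
  obtain x z where q: "q = (x, z)" by (cases q)
  have xz: "Poly_Mapping.keys x \<subseteq> Q0_basis n"
    "\<And>p. p \<in> prime_divs n \<Longrightarrow> Poly_Mapping.keys (z p) \<subseteq> Qp_basis n p"
    using assms(3) unfolding q mem_Q_sum_iff[OF assms(1)] by blast+
  have "Poly_Mapping.keys (Q0_act \<sigma> x) \<subseteq> Q0_basis n"
    unfolding linear_perm_Q by (rule keys_frag_map_subset[OF xz(1) permutes_Q0_basis[OF assms(2)]])
  moreover have "Poly_Mapping.keys (Qp_act \<sigma> (z p)) \<subseteq> Qp_basis n p" if "p \<in> prime_divs n" for p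
    unfolding linear_perm_Q
    by (rule keys_frag_map_subset[OF xz(2)[OF that] permutes_Qp_basis[OF assms(2)]])
  ultimately have "(Q0_act \<sigma> x, \<lambda>p\<in>prime_divs n. Qp_act \<sigma> (z p)) \<in> carrier (Q_sum n)"
    unfolding mem_Q_sum_iff[OF assms(1)] by simp
  then show ?thesis by (simp add: q Q_act_def)
qed

lemma permutation_lattice_Q_sum:
  assumes n: "n \<ge> 2"
  shows "permutation_lattice (sym_group n) (Q_sum n) (Q_act n)"
proof -
  let ?S = "Q0_basis n <+> Sigma (prime_divs n) (Qp_basis n)"
  let ?B = "(\<lambda>s. free_product_map (prime_divs n) (frag_of s)) ` ?S"
  have fin: "finite ?B"
    by (intro finite_imageI finite_Plus finite_SigmaI finite_Q0_basis finite_prime_divs[OF n]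
        finite_Qp_basis)
  have basis: "Z_basis (Q_sum n) ?B"
    unfolding Q_sum_eq
    by (rule Z_basis_iso_image[OF iso_free_product_map[OF finite_prime_divs[OF n]]])
  have stable: "Q_act n \<sigma> ` ?B \<subseteq> ?B" if "\<sigma> \<in> carrier (sym_group n)" for \<sigma>
  proof (rule image_subsetI)
    have \<sigma>: "\<sigma> permutes {1..n}" using that by (simp add: sym_group_carrier)
    fix b assume "b \<in> ?B"
    then obtain s where s: "s \<in> ?S" and b: "b = free_product_map (prime_divs n) (frag_of s)" by blast
    show "Q_act n \<sigma> b \<in> ?B"
    proof (cases s)
      case (Inl c)
      then have "Q_act n \<sigma> b = free_product_map (prime_divs n) (frag_of (Inl (map_prod \<sigma> \<sigma> c)))"
        by (auto simp: b Q_act_def linear_perm_Q)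
      moreover have "Inl (map_prod \<sigma> \<sigma> c) \<in> ?S" using s Inl permutes_Q0_basis[OF \<sigma>] by auto
      ultimately show ?thesis by blast
    next
      case (Inr d)
      obtain p c where d: "d = (p, c)" by (cases d)
      have "Q_act n \<sigma> b
          = free_product_map (prime_divs n) (frag_of (Inr (p, map_prod (image \<sigma>) (image \<sigma>) c)))"
        by (auto simp: b Inr d Q_act_def linear_perm_Q)
      moreover have "Inr (p, map_prod (image \<sigma>) (image \<sigma>) c) \<in> ?S"
        using s Inr d permutes_Qp_basis[OF \<sigma>] by auto
      ultimately show ?thesis by blast
    qed
  qed
  have "G_lattice (sym_group n) (Q_sum n) (Q_act n)"
  proof (intro G_lattice.intro G_lattice_axioms.intro)
    show "group (sym_group n)" by (rule sym_group_is_group)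
    show "comm_group (Q_sum n)" unfolding Q_sum_eq by (rule comm_group_free_product)
    show "\<exists>B. finite B \<and> Z_basis (Q_sum n) B" using fin basis by blast
    show "Q_act n \<sigma> \<in> hom (Q_sum n) (Q_sum n)" if "\<sigma> \<in> carrier (sym_group n)" for \<sigma>
    proof (rule homI)
      show "Q_act n \<sigma> q \<in> carrier (Q_sum n)" if "q \<in> carrier (Q_sum n)" for q
        using Q_act_closed[OF n _ that] \<open>\<sigma> \<in> _\<close> by (simp add: sym_group_carrier)
      show "Q_act n \<sigma> (q \<otimes>\<^bsub>Q_sum n\<^esub> q') = Q_act n \<sigma> q \<otimes>\<^bsub>Q_sum n\<^esub> Q_act n \<sigma> q'" for q q'
        by (cases q; cases q')
           (auto simp: Q_act_def mult_Q_sum linear_perm_Q frag_map_add)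
    qed
    show "Q_act n \<one>\<^bsub>sym_group n\<^esub> q = q" if "q \<in> carrier (Q_sum n)" for q
    proof -
      obtain x z where q: "q = (x, z)" by (cases q)
      have "z \<in> extensional (prime_divs n)" using that unfolding q mem_Q_sum_iff[OF n] by blast
      then show ?thesis
        by (auto simp: q Q_act_def linear_perm_Q sym_group_one map_prod.id extensional_def)
    qed
    show "Q_act n (\<sigma> \<otimes>\<^bsub>sym_group n\<^esub> \<tau>) q = Q_act n \<sigma> (Q_act n \<tau> q)" for \<sigma> \<tau> q
    proof -
      have "image (\<sigma> \<circ> \<tau>) = image \<sigma> \<circ> image \<tau>" by (simp add: fun_eq_iff image_comp)
      then show ?thesis
        by (cases q) (auto simp: Q_act_def linear_perm_Q sym_group_mult frag_map_compose map_prod.comp)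
    qed
  qed
  then show ?thesis
    unfolding permutation_lattice_def
    by (intro conjI exI[of _ ?B] ballI) (assumption | rule fin basis stable)+
qed

text \<open>The functional whose kernel in \<open>\<int>\<^sup>n\<close> is the root lattice.\<close>

definition coeff_sum :: "nat \<Rightarrow> (nat \<Rightarrow>\<^sub>0 int) \<Rightarrow> int" where
  "coeff_sum n x = (\<Sum>i\<in>{1..n}. Poly_Mapping.lookup x i)"

lemma coeff_sum_add: "coeff_sum n (x + y) = coeff_sum n x + coeff_sum n y"
  by (simp add: coeff_sum_def lookup_add sum.distrib)

lemma coeff_sum_diff: "coeff_sum n (x - y) = coeff_sum n x - coeff_sum n y"
  by (simp add: coeff_sum_def lookup_minus sum_subtractf)

lemma coeff_sum_cmul: "coeff_sum n (frag_cmul c x) = c * coeff_sum n x"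
  by (simp add: coeff_sum_def sum_distrib_left)

lemma coeff_sum_sum: "coeff_sum n (\<Sum>i\<in>A. x i) = (\<Sum>i\<in>A. coeff_sum n (x i))"
  unfolding coeff_sum_def lookup_sum by (rule sum.swap)

lemma coeff_sum_frag_of: "i \<in> {1..n} \<Longrightarrow> coeff_sum n (frag_of i) = 1"
  by (simp add: coeff_sum_def)

lemma mem_root_lattice_iff:
  "x \<in> carrier (root_lattice n) \<longleftrightarrow> Poly_Mapping.keys x \<subseteq> {1..n} \<and> coeff_sum n x = 0"
  by (simp add: root_lattice_def coeff_sum_def)

lemma root_lattice_simps [simp]:
  "x \<otimes>\<^bsub>root_lattice n\<^esub> y = x + y" "\<one>\<^bsub>root_lattice n\<^esub> = 0"
  by (simp_all add: root_lattice_def)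

lemma subgroup_root_lattice: "subgroup (carrier (root_lattice n)) (free_Abelian_group {1..n})"
proof (rule group.subgroupI[OF group_free_Abelian_group])
  have "0 \<in> carrier (root_lattice n)" by (simp add: mem_root_lattice_iff coeff_sum_def)
  then show "carrier (root_lattice n) \<noteq> {}" by blast
next
  fix x y assume x: "x \<in> carrier (root_lattice n)" and y: "y \<in> carrier (root_lattice n)"
  show "inv\<^bsub>free_Abelian_group {1..n}\<^esub> x \<in> carrier (root_lattice n)"
    using x coeff_sum_diff[of n 0 x] by (simp add: mem_root_lattice_iff coeff_sum_def)
  show "x \<otimes>\<^bsub>free_Abelian_group {1..n}\<^esub> y \<in> carrier (root_lattice n)"
    using x y keys_add[of x y] by (auto simp: mem_root_lattice_iff coeff_sum_add)
qed (auto simp: mem_root_lattice_iff)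

lemma coeff_sum_frag_map:
  assumes \<sigma>: "\<sigma> permutes {1..n}" and x: "Poly_Mapping.keys x \<subseteq> {1..n}"
  shows "coeff_sum n (frag_map \<sigma> x) = coeff_sum n x"
proof -
  have "coeff_sum n (frag_map \<sigma> x) = (\<Sum>i\<in>{1..n}. Poly_Mapping.lookup (frag_map \<sigma> x) (\<sigma> i))"
    unfolding coeff_sum_def by (subst sum.permute[OF \<sigma>]) (simp add: comp_def)
  also have "\<dots> = coeff_sum n x"
    unfolding coeff_sum_def
    by (intro sum.cong refl lookup_frag_map[OF permutes_inj_on[OF \<sigma>] x])
  finally show ?thesis .
qed

lemma root_act_closed:
  assumes "\<sigma> permutes {1..n}" "x \<in> carrier (root_lattice n)"
  shows "root_act \<sigma> x \<in> carrier (root_lattice n)"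
proof -
  have x: "Poly_Mapping.keys x \<subseteq> {1..n}" "coeff_sum n x = 0"
    using assms(2) by (simp_all only: mem_root_lattice_iff)
  have "Poly_Mapping.keys (root_act \<sigma> x) \<subseteq> {1..n}"
    unfolding linear_perm_Q
    by (rule keys_frag_map_subset[OF x(1)]) (simp only: permutes_in_image[OF assms(1)])
  then show ?thesis
    using x by (simp only: mem_root_lattice_iff linear_perm_Q coeff_sum_frag_map[OF assms(1) x(1)])
qed

lemma G_lattice_root_lattice: "G_lattice (sym_group n) (root_lattice n) root_act"
proof (intro G_lattice.intro G_lattice_axioms.intro)
  let ?Z = "free_Abelian_group {1..n}"
  have root: "root_lattice n = ?Z\<lparr>carrier := carrier (root_lattice n)\<rparr>"
    by (simp add: root_lattice_def)
  have "frag_map id \<in> iso ?Z ?Z" by (rule iso_frag_map) simp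
  from Z_basis_iso_image[OF this] have "Z_basis ?Z (frag_of ` {1..n})" by simp
  from subgroup_Z_basis[OF group_free_Abelian_group _ this subgroup_root_lattice]
  show "\<exists>B. finite B \<and> Z_basis (root_lattice n) B" using root by simp
  have "group (root_lattice n)"
    using group.subgroup_imp_group[OF group_free_Abelian_group subgroup_root_lattice[of n]] root by simp
  then show "comm_group (root_lattice n)"
    by (rule group.group_comm_groupI) (simp add: add.commute)
  show "root_act \<sigma> \<in> hom (root_lattice n) (root_lattice n)" if "\<sigma> \<in> carrier (sym_group n)" for \<sigma>
    using that root_act_closed[of \<sigma> n]
    by (intro homI) (simp_all add: sym_group_carrier linear_perm_Q frag_map_add)
qed (simp_all add: sym_group_is_group linear_perm_Q sym_group_one sym_group_mult frag_map_compose)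

lemma lookup_sum_frag_of:
  assumes "finite A"
  shows "Poly_Mapping.lookup (\<Sum>i\<in>A. frag_of i) k = (if k \<in> A then 1 else 0)"
  using assms by (simp add: lookup_sum)

lemma keys_sum_frag_of: "finite A \<Longrightarrow> Poly_Mapping.keys (\<Sum>i\<in>A. frag_of i) = A"
  by (simp add: set_eq_iff in_keys_iff lookup_sum_frag_of)

lemma frag_extend_mem_root_lattice:
  assumes "\<And>b. b \<in> Poly_Mapping.keys x \<Longrightarrow> F b \<in> carrier (root_lattice n)"
  shows "frag_extend F x \<in> carrier (root_lattice n)"
proof -
  have "Poly_Mapping.keys (frag_extend F x) \<subseteq> {1..n}"
    using assms by (intro order.trans[OF keys_frag_extend UN_least]) (simp only: mem_root_lattice_iff)
  moreover have "coeff_sum n (frag_extend F x) = 0"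
    using assms by (simp add: frag_extend_def coeff_sum_sum coeff_sum_cmul mem_root_lattice_iff)
  ultimately show ?thesis by (simp only: mem_root_lattice_iff)
qed

lemma simple_root_mem_root_lattice:
  assumes "(i, j) \<in> Q0_basis n"
  shows "frag_of i - frag_of j \<in> carrier (root_lattice n)"
proof -
  have ij: "i \<in> {1..n}" "j \<in> {1..n}" using assms unfolding Q0_basis_def by blast+
  then have "Poly_Mapping.keys (frag_of i - frag_of j) \<subseteq> {1..n}"
    by (intro order.trans[OF keys_diff]) simp
  moreover have "coeff_sum n (frag_of i - frag_of j) = 0"
    by (simp only: coeff_sum_diff coeff_sum_frag_of ij diff_self)
  ultimately show ?thesis by (simp only: mem_root_lattice_iff)
qed

lemma s_vec_mem_root_lattice:
  assumes IJ: "I \<subseteq> {1..n}" "J \<subseteq> {1..n}"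
  shows "s_vec I J \<in> carrier (root_lattice n)"
proof -
  have fin: "finite I" "finite J" using IJ finite_subset by blast+
  have keys: "Poly_Mapping.keys (frag_cmul c (\<Sum>i\<in>A. frag_of i)) \<subseteq> {1..n}"
    if "A \<subseteq> {1..n}" "finite A" for c and A :: "nat set"
    using keys_cmul[of c "\<Sum>i\<in>A. frag_of i"] that by (simp only: keys_sum_frag_of)
  have "Poly_Mapping.keys (s_vec I J) \<subseteq> {1..n}"
    unfolding s_vec_def using keys IJ fin by (intro order.trans[OF keys_diff] Un_least) blast+
  moreover have "coeff_sum n (s_vec I J) = 0"
  proof -
    have "coeff_sum n (\<Sum>i\<in>A. frag_of i) = int (card A)" if "A \<subseteq> {1..n}" for A
    proof -
      have "coeff_sum n (\<Sum>i\<in>A. frag_of i) = (\<Sum>i\<in>A. 1)"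
        unfolding coeff_sum_sum using that by (intro sum.cong refl coeff_sum_frag_of) blast
      then show ?thesis by simp
    qed
    moreover have "b div gcd a b * a = a div gcd a b * b" for a b :: int
      using div_mult_swap[of "gcd a b" b a] div_mult_swap[of "gcd a b" a b] by (simp add: mult.commute)
    ultimately show ?thesis
      using IJ by (simp only: s_vec_def coeff_sum_diff coeff_sum_cmul diff_self)
  qed
  ultimately show ?thesis by (simp only: mem_root_lattice_iff)
qed

lemma resolution_map_mem:
  assumes n: "n \<ge> 2" and q: "q \<in> carrier (Q_sum n)"
  shows "resolution_map n q \<in> carrier (root_lattice n)"
proof -
  interpret R: subgroup "carrier (root_lattice n)" "free_Abelian_group {1..n}"
    by (rule subgroup_root_lattice)
  have add: "x + y \<in> carrier (root_lattice n)"
    if "x \<in> carrier (root_lattice n)" "y \<in> carrier (root_lattice n)" for x y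
    using R.m_closed[OF that] by simp
  obtain x z where xz: "q = (x, z)" by (cases q)
  have kx: "Poly_Mapping.keys x \<subseteq> Q0_basis n"
    and kz: "\<And>p. p \<in> prime_divs n \<Longrightarrow> Poly_Mapping.keys (z p) \<subseteq> Qp_basis n p"
    using q unfolding xz mem_Q_sum_iff[OF n] by blast+
  have "frag_extend (\<lambda>(i, j). frag_of i - frag_of j) x \<in> carrier (root_lattice n)"
    using kx by (intro frag_extend_mem_root_lattice) (auto intro: simple_root_mem_root_lattice)
  moreover have "frag_extend (\<lambda>(I, J). s_vec I J) (z p) \<in> carrier (root_lattice n)"
    if "p \<in> prime_divs n" for p
  proof (rule frag_extend_mem_root_lattice)
    fix b assume "b \<in> Poly_Mapping.keys (z p)"
    then have "b \<in> Qp_basis n p" using kz[OF that] by blast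
    then obtain I J where "b = (I, J)" "I \<subseteq> {1..n}" "J \<subseteq> {1..n}" unfolding Qp_basis_def by blast
    then show "(\<lambda>(I, J). s_vec I J) b \<in> carrier (root_lattice n)"
      using s_vec_mem_root_lattice by simp
  qed
  then have "(\<Sum>p\<in>T. frag_extend (\<lambda>(I, J). s_vec I J) (z p)) \<in> carrier (root_lattice n)"
    if "T \<subseteq> prime_divs n" for T
    using that
  proof (induction T rule: infinite_finite_induct)
    case (insert p T)
    then show ?case using add by simp
  qed (use R.one_closed in simp_all)
  ultimately show ?thesis using add by (simp add: xz resolution_map_def)
qed

lemma resolution_map_add:
  "resolution_map n (q \<otimes>\<^bsub>Q_sum n\<^esub> q') = resolution_map n q + resolution_map n q'"
  by (cases q; cases q')
     (simp add: mult_Q_sum resolution_map_def frag_extend_add sum.distrib cong: sum.cong)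

lemma resolution_map_hom: "n \<ge> 2 \<Longrightarrow> resolution_map n \<in> hom (Q_sum n) (root_lattice n)"
  by (intro homI) (simp_all add: resolution_map_mem resolution_map_add)

lemma s_vec_image:
  assumes "inj \<sigma>"
  shows "s_vec (\<sigma> ` I) (\<sigma> ` J) = frag_map \<sigma> (s_vec I J)"
proof -
  have inj: "inj_on \<sigma> A" for A using assms by (rule inj_on_subset) simp
  have [simp]: "card (\<sigma> ` A) = card A" for A by (rule card_image[OF inj])
  have [simp]: "frag_map \<sigma> (\<Sum>i\<in>A. frag_of i) = (\<Sum>i\<in>\<sigma> ` A. frag_of i)" for A
    by (simp add: frag_map_sum sum.reindex[OF inj])
  show ?thesis
    unfolding s_vec_def by (simp add: frag_map_diff frag_map_cmul)
qed

lemma equivariant_resolution_map: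
  "equivariant (sym_group n) (Q_sum n) (Q_act n) root_act (resolution_map n)"
  unfolding equivariant_def
proof (intro ballI)
  fix \<sigma> and q :: Q_elem
  assume "\<sigma> \<in> carrier (sym_group n)"
  then have inj: "inj \<sigma>" by (simp add: sym_group_carrier permutes_inj)
  obtain x z where q: "q = (x, z)" by (cases q)
  have "frag_extend (\<lambda>(i, j). frag_of i - frag_of j) (Q0_act \<sigma> x)
      = frag_map \<sigma> (frag_extend (\<lambda>(i, j). frag_of i - frag_of j) x)"
    unfolding linear_perm_Q frag_extend_frag_map frag_map_frag_extend
    by (rule frag_extend_eq) (auto simp: frag_map_diff)
  moreover have "frag_extend (\<lambda>(I, J). s_vec I J) (Qp_act \<sigma> y)
      = frag_map \<sigma> (frag_extend (\<lambda>(I, J). s_vec I J) y)" for y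
    unfolding linear_perm_Q frag_extend_frag_map frag_map_frag_extend
    by (rule frag_extend_eq) (auto simp: s_vec_image[OF inj])
  ultimately show "resolution_map n (Q_act n \<sigma> q) = root_act \<sigma> (resolution_map n q)"
    by (simp add: q resolution_map_def Q_act_def linear_perm_Q(3) frag_map_add frag_map_sum
        cong: sum.cong)
qed


section \<open>Lifting invariant vectors\<close>

text \<open>The images of those \<open>q\<close> whose stabiliser contains the stabiliser of \<open>x\<close>. The point is to
  show that \<open>x\<close> itself is such an image; being a subgroup, the set can be attacked one prime at a
  time.\<close>

definition liftable :: "nat \<Rightarrow> (nat \<Rightarrow>\<^sub>0 int) \<Rightarrow> (nat \<Rightarrow>\<^sub>0 int) set" where
  "liftable n x = {y. \<exists>q\<in>carrier (Q_sum n). resolution_map n q = y \<and>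
     (\<forall>\<sigma>\<in>carrier (sym_group n). root_act \<sigma> x = x \<longrightarrow> Q_act n \<sigma> q = q)}"

lemma liftableI:
  assumes "n \<ge> 2" "Poly_Mapping.keys u \<subseteq> Q0_basis n" "z \<in> extensional (prime_divs n)"
    and "\<And>p. p \<in> prime_divs n \<Longrightarrow> Poly_Mapping.keys (z p) \<subseteq> Qp_basis n p"
    and "\<And>\<sigma>. \<lbrakk>\<sigma> permutes {1..n}; root_act \<sigma> x = x\<rbrakk> \<Longrightarrow> Q0_act \<sigma> u = u"
    and "\<And>\<sigma> p. \<lbrakk>\<sigma> permutes {1..n}; root_act \<sigma> x = x; p \<in> prime_divs n\<rbrakk> \<Longrightarrow> Qp_act \<sigma> (z p) = z p"
    and "resolution_map n (u, z) = y"
  shows "y \<in> liftable n x"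
proof -
  have "(u, z) \<in> carrier (Q_sum n)" unfolding mem_Q_sum_iff[OF assms(1)] using assms(2-4) by blast
  moreover have "Q_act n \<sigma> (u, z) = (u, z)"
    if "\<sigma> \<in> carrier (sym_group n)" "root_act \<sigma> x = x" for \<sigma>
    using that assms(3,5,6) by (auto simp: sym_group_carrier Q_act_def extensional_def)
  ultimately show ?thesis using assms(7) unfolding liftable_def by blast
qed

lemma zero_liftable:
  assumes "n \<ge> 2"
  shows "0 \<in> liftable n x"
  by (rule liftableI[OF assms, where u = 0 and z = "\<lambda>p\<in>prime_divs n. 0"])
     (simp_all add: resolution_map_def linear_perm_Q)

lemma liftable_diff:
  assumes n: "n \<ge> 2" and "y \<in> liftable n x" "y' \<in> liftable n x"
  shows "y - y' \<in> liftable n x"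
proof -
  obtain u z where q: "(u, z) \<in> carrier (Q_sum n)" "resolution_map n (u, z) = y"
    and fq: "\<And>\<sigma>. \<lbrakk>\<sigma> \<in> carrier (sym_group n); root_act \<sigma> x = x\<rbrakk> \<Longrightarrow> Q_act n \<sigma> (u, z) = (u, z)"
    using assms(2) unfolding liftable_def by fast
  obtain u' z' where q': "(u', z') \<in> carrier (Q_sum n)" "resolution_map n (u', z') = y'"
    and fq': "\<And>\<sigma>. \<lbrakk>\<sigma> \<in> carrier (sym_group n); root_act \<sigma> x = x\<rbrakk> \<Longrightarrow> Q_act n \<sigma> (u', z') = (u', z')"
    using assms(3) unfolding liftable_def by fast
  note c = q(1)[unfolded mem_Q_sum_iff[OF n]] q'(1)[unfolded mem_Q_sum_iff[OF n]]
  have fix0: "Q0_act \<sigma> u = u" "Q0_act \<sigma> u' = u'"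
    if "\<sigma> permutes {1..n}" "root_act \<sigma> x = x" for \<sigma>
    using fq[OF _ that(2)] fq'[OF _ that(2)] that(1) by (simp_all add: sym_group_carrier Q_act_def)
  have fixp: "Qp_act \<sigma> (z p) = z p" "Qp_act \<sigma> (z' p) = z' p"
    if "\<sigma> permutes {1..n}" "root_act \<sigma> x = x" "p \<in> prime_divs n" for \<sigma> p
  proof -
    have "(\<lambda>p\<in>prime_divs n. Qp_act \<sigma> (z p)) = z" "(\<lambda>p\<in>prime_divs n. Qp_act \<sigma> (z' p)) = z'"
      using fq[OF _ that(2)] fq'[OF _ that(2)] that(1) by (simp_all add: sym_group_carrier Q_act_def)
    from fun_cong[OF this(1), of p] fun_cong[OF this(2), of p] that(3)
    show "Qp_act \<sigma> (z p) = z p" "Qp_act \<sigma> (z' p) = z' p" by simp_all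
  qed
  show ?thesis
  proof (rule liftableI[OF n, where u = "u - u'" and z = "\<lambda>p\<in>prime_divs n. z p - z' p"])
    show "Poly_Mapping.keys (u - u') \<subseteq> Q0_basis n"
      using c keys_diff[of u u'] by blast
    show "Poly_Mapping.keys ((\<lambda>p\<in>prime_divs n. z p - z' p) p) \<subseteq> Qp_basis n p"
      if "p \<in> prime_divs n" for p
    proof -
      have "Poly_Mapping.keys (z p) \<subseteq> Qp_basis n p" "Poly_Mapping.keys (z' p) \<subseteq> Qp_basis n p"
        using c that by blast+
      then have "Poly_Mapping.keys (z p - z' p) \<subseteq> Qp_basis n p" using keys_diff[of "z p" "z' p"] by blast
      then show ?thesis using that by simp
    qed
    show "Q0_act \<sigma> (u - u') = u - u'" if "\<sigma> permutes {1..n}" "root_act \<sigma> x = x" for \<sigma>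
      using fix0[OF that] by (simp add: linear_perm_Q frag_map_diff)
    show "Qp_act \<sigma> ((\<lambda>p\<in>prime_divs n. z p - z' p) p) = (\<lambda>p\<in>prime_divs n. z p - z' p) p"
      if "\<sigma> permutes {1..n}" "root_act \<sigma> x = x" "p \<in> prime_divs n" for \<sigma> p
      using fixp[OF that] that(3) by (simp add: linear_perm_Q frag_map_diff)
    show "resolution_map n (u - u', \<lambda>p\<in>prime_divs n. z p - z' p) = y - y'"
      unfolding q(2)[symmetric] q'(2)[symmetric]
      by (simp add: resolution_map_def frag_extend_diff sum_subtractf cong: sum.cong)
  qed simp
qed

lemma liftable_cmul: "n \<ge> 2 \<Longrightarrow> y \<in> liftable n x \<Longrightarrow> frag_cmul k y \<in> liftable n x"
  by (rule frag_closure_minus_cmul) (auto intro: zero_liftable liftable_diff)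

lemma liftable_minus: "n \<ge> 2 \<Longrightarrow> y \<in> liftable n x \<Longrightarrow> - y \<in> liftable n x"
  using liftable_diff[of n 0 x y] zero_liftable by simp

lemma liftable_sum:
  assumes "n \<ge> 2" "\<And>i. i \<in> A \<Longrightarrow> y i \<in> liftable n x"
  shows "(\<Sum>i\<in>A. y i) \<in> liftable n x"
  using assms(2)
proof (induction A rule: infinite_finite_induct)
  case (insert i A)
  then show ?case
    using liftable_diff[OF assms(1), of "y i" x "- (\<Sum>i\<in>A. y i)"] liftable_minus[OF assms(1)] by simp
qed (simp_all add: zero_liftable assms(1))

lemma liftable_subset_root_lattice: "n \<ge> 2 \<Longrightarrow> liftable n x \<subseteq> carrier (root_lattice n)"
  using resolution_map_mem unfolding liftable_def by blast

text \<open>The level sets replace orbits: if \<open>\<sigma>\<close> fixes \<open>x\<close>, then \<open>\<sigma>\<close> maps each level set of \<open>x\<close> to itself,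
  so a sum of basis elements taken over a set that is described by level sets alone has at least the
  stabiliser of \<open>x\<close>.\<close>

definition level :: "nat \<Rightarrow> (nat \<Rightarrow>\<^sub>0 int) \<Rightarrow> int \<Rightarrow> nat set" where
  "level n x c = {i \<in> {1..n}. Poly_Mapping.lookup x i = c}"

lemma level_subset: "level n x c \<subseteq> {1..n}" and finite_level: "finite (level n x c)"
  by (auto simp: level_def)

lemma level_disjoint: "c \<noteq> d \<Longrightarrow> level n x c \<inter> level n x d = {}"
  by (auto simp: level_def)

lemma image_level:
  assumes \<sigma>: "\<sigma> permutes {1..n}" and x: "x \<in> carrier (root_lattice n)" and fx: "root_act \<sigma> x = x"
  shows "\<sigma> ` level n x c = level n x c"
proof (rule endo_inj_surj[OF finite_level])
  have k: "Poly_Mapping.keys x \<subseteq> {1..n}" using x by (simp only: mem_root_lattice_iff)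
  have "Poly_Mapping.lookup x (\<sigma> i) = Poly_Mapping.lookup x i" if "i \<in> {1..n}" for i
    using lookup_frag_map[OF permutes_inj_on[OF \<sigma>] k that] fx by (simp add: linear_perm_Q)
  then show "\<sigma> ` level n x c \<subseteq> level n x c"
    unfolding level_def using permutes_in_image[OF \<sigma>] by blast
  show "inj_on \<sigma> (level n x c)" by (rule permutes_inj_on[OF \<sigma>])
qed

lemma frag_map_sum_fixed:
  assumes "finite T" "inj_on f T" "\<And>b. b \<in> T \<Longrightarrow> f b \<in> T"
  shows "frag_map f (\<Sum>b\<in>T. frag_of b) = (\<Sum>b\<in>T. frag_of b)"
proof -
  have "f ` T = T" by (rule endo_inj_surj) (use assms in auto)
  then have "bij_betw f T T" using assms(2) by (simp add: bij_betw_def)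
  from sum.reindex_bij_betw[OF this, of frag_of] show ?thesis by (simp add: frag_map_sum)
qed

lemma sum_const_frag: "(\<Sum>i\<in>A. x) = frag_cmul (int (card A)) x"
  by (rule poly_mapping_eqI) (simp add: lookup_sum)

text \<open>The sum of all \<open>y\<^sub>i\<^sub>j\<close> with \<open>i\<close> in one level set and \<open>j\<close> in another. The coefficient at the second
  level set is the size of the first, so this serves the primes not dividing that size.\<close>

lemma liftable_points:
  assumes n: "n \<ge> 2" and x: "x \<in> carrier (root_lattice n)" and cd: "c \<noteq> d"
  defines "O1 \<equiv> level n x c" and "O2 \<equiv> level n x d"
  shows "frag_cmul (int (card O2)) (\<Sum>i\<in>O1. frag_of i) - frag_cmul (int (card O1)) (\<Sum>i\<in>O2. frag_of i)
           \<in> liftable n x"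
proof (rule liftableI[OF n, where u = "\<Sum>b\<in>O1 \<times> O2. frag_of b" and z = "\<lambda>p\<in>prime_divs n. 0"])
  have fin: "finite O1" "finite O2" by (simp_all add: O1_def O2_def finite_level)
  show "Poly_Mapping.keys (\<Sum>b\<in>O1 \<times> O2. frag_of b) \<subseteq> Q0_basis n"
  proof -
    have "O1 \<times> O2 \<subseteq> Q0_basis n"
      using cd by (auto simp: Q0_basis_def O1_def O2_def level_def)
    then show ?thesis using fin by (simp only: keys_sum_frag_of finite_cartesian_product)
  qed
  show "Q0_act \<sigma> (\<Sum>b\<in>O1 \<times> O2. frag_of b) = (\<Sum>b\<in>O1 \<times> O2. frag_of b)"
    if \<sigma>: "\<sigma> permutes {1..n}" "root_act \<sigma> x = x" for \<sigma>
    unfolding linear_perm_Q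
  proof (rule frag_map_sum_fixed)
    show "inj_on (map_prod \<sigma> \<sigma>) (O1 \<times> O2)"
      by (intro map_prod_inj_on permutes_inj_on[OF \<sigma>(1)])
    show "map_prod \<sigma> \<sigma> b \<in> O1 \<times> O2" if "b \<in> O1 \<times> O2" for b
      using that image_level[OF \<sigma>(1) x \<sigma>(2)] unfolding O1_def O2_def by (cases b) fastforce
  qed (use fin in simp)
  show "resolution_map n (\<Sum>b\<in>O1 \<times> O2. frag_of b, \<lambda>p\<in>prime_divs n. 0)
      = frag_cmul (int (card O2)) (\<Sum>i\<in>O1. frag_of i) - frag_cmul (int (card O1)) (\<Sum>i\<in>O2. frag_of i)"
  proof (rule poly_mapping_eqI)
    fix k
    have "Poly_Mapping.lookup (\<Sum>(i, j)\<in>O1 \<times> O2. frag_of i - frag_of j) k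
        = (\<Sum>i\<in>O1. \<Sum>j\<in>O2. (if k = i then 1 else 0) - (if k = j then 1 else 0))"
      by (simp add: lookup_sum lookup_minus sum.cartesian_product case_prod_unfold)
    also have "\<dots> = int (card O2) * (if k \<in> O1 then 1 else 0) - int (card O1) * (if k \<in> O2 then 1 else 0)"
      using fin by (simp add: sum_subtractf sum_distrib_left[symmetric])
    finally show "Poly_Mapping.lookup (resolution_map n (\<Sum>b\<in>O1 \<times> O2. frag_of b, \<lambda>p\<in>prime_divs n. 0)) k
      = Poly_Mapping.lookup (frag_cmul (int (card O2)) (\<Sum>i\<in>O1. frag_of i)
          - frag_cmul (int (card O1)) (\<Sum>i\<in>O2. frag_of i)) k"
      using fin
      by (simp add: resolution_map_def frag_extend_sum comp_def case_prod_unfold lookup_minus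
          lookup_sum_frag_of)
  qed
qed (simp_all add: linear_perm_Q)

definition subsets_of_card :: "'a set \<Rightarrow> nat \<Rightarrow> 'a set set" where
  "subsets_of_card A k = {I. I \<subseteq> A \<and> card I = k}"

lemma finite_subsets_of_card: "finite A \<Longrightarrow> finite (subsets_of_card A k)"
  by (rule finite_subset[of _ "Pow A"]) (auto simp: subsets_of_card_def)

lemma card_subsets_of_card: "finite A \<Longrightarrow> card (subsets_of_card A k) = card A choose k"
  unfolding subsets_of_card_def by (rule n_subsets)

lemma card_subsets_of_card_containing:
  assumes A: "finite A" and i: "i \<in> A" and k: "k > 0"
  shows "card {I \<in> subsets_of_card A k. i \<in> I} = (card A - 1) choose (k - 1)"
proof -
  have "{I \<in> subsets_of_card A k. i \<in> I} = insert i ` subsets_of_card (A - {i}) (k - 1)"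
  proof (rule subset_antisym; rule subsetI)
    fix I assume I: "I \<in> {I \<in> subsets_of_card A k. i \<in> I}"
    then have "I = insert i (I - {i})" "card (I - {i}) = k - 1"
      by (auto simp: subsets_of_card_def)
    with I show "I \<in> insert i ` subsets_of_card (A - {i}) (k - 1)"
      by (intro image_eqI[of _ _ "I - {i}"]) (auto simp: subsets_of_card_def)
  next
    fix I assume "I \<in> insert i ` subsets_of_card (A - {i}) (k - 1)"
    then obtain J where J: "I = insert i J" "J \<subseteq> A - {i}" "card J = k - 1"
      by (auto simp: subsets_of_card_def)
    then have "finite J" "i \<notin> J" using A finite_subset by blast+
    with J show "I \<in> {I \<in> subsets_of_card A k. i \<in> I}"
      using i k by (auto simp: subsets_of_card_def)
  qed
  moreover have "inj_on (insert i) (subsets_of_card (A - {i}) (k - 1))"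
    by (rule inj_onI) (auto simp: subsets_of_card_def)
  ultimately show ?thesis
    using A i by (simp add: card_image card_subsets_of_card)
qed

lemma sum_subsets_of_card:
  assumes A: "finite A" and k: "k > 0"
  shows "(\<Sum>I\<in>subsets_of_card A k. \<Sum>i\<in>I. frag_of i)
    = frag_cmul (int ((card A - 1) choose (k - 1))) (\<Sum>i\<in>A. frag_of i)"
proof (rule poly_mapping_eqI)
  fix j
  have fin: "finite I" if "I \<in> subsets_of_card A k" for I
    using that A finite_subset by (auto simp: subsets_of_card_def)
  have "Poly_Mapping.lookup (\<Sum>I\<in>subsets_of_card A k. \<Sum>i\<in>I. frag_of i) j
      = (\<Sum>I\<in>subsets_of_card A k. if j \<in> I then 1 else 0)"
    unfolding lookup_sum[of _ "subsets_of_card A k"]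
    by (intro sum.cong refl lookup_sum_frag_of fin)
  also have "\<dots> = int (card {I \<in> subsets_of_card A k. j \<in> I})"
    using finite_subsets_of_card[OF A] by (simp add: sum.If_cases Int_def)
  also have "\<dots> = int ((card A - 1) choose (k - 1)) * (if j \<in> A then 1 else 0)"
  proof (cases "j \<in> A")
    case True
    then show ?thesis using card_subsets_of_card_containing[OF A _ k] by simp
  next
    case False
    then have "{I \<in> subsets_of_card A k. j \<in> I} = {}" by (auto simp: subsets_of_card_def)
    then show ?thesis using False by (simp only: card.empty) simp
  qed
  finally show "Poly_Mapping.lookup (\<Sum>I\<in>subsets_of_card A k. \<Sum>i\<in>I. frag_of i) j
    = Poly_Mapping.lookup (frag_cmul (int ((card A - 1) choose (k - 1))) (\<Sum>i\<in>A. frag_of i)) j"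
    using A by (simp add: lookup_sum_frag_of)
qed

text \<open>Wielandt's count from the proof of the Sylow theorem. It makes the coefficient in the next
  lift prime to \<open>p\<close>, without passing to a Sylow subgroup.\<close>

lemma prime_not_dvd_binomial:
  fixes p m r :: nat
  assumes p: "prime p" and m: "\<not> p dvd m"
  shows "\<not> p dvd (p ^ r * m choose p ^ r)" "\<not> p dvd (p ^ r * m - 1 choose (p ^ r - 1))"
proof -
  have m0: "m > 0" using m by (cases m) auto
  have "multiplicity p (p ^ r * m choose p ^ r) = 0"
    using const_p_fac[OF m0 p, of r] m by (simp add: not_dvd_imp_multiplicity_0)
  moreover have "p ^ r * m choose p ^ r \<noteq> 0" using m0 by simp
  ultimately show *: "\<not> p dvd (p ^ r * m choose p ^ r)"
    using p prime_multiplicity_gt_zero_iff[of p "p ^ r * m choose p ^ r"] by auto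
  have pr: "p ^ r > 0" using p by (simp add: prime_gt_0_nat)
  have "p ^ r * (p ^ r * m choose p ^ r) = p ^ r * m * (p ^ r * m - 1 choose (p ^ r - 1))"
    by (rule times_binomial_minus1_eq[OF pr])
  then have "(p ^ r * m choose p ^ r) = m * (p ^ r * m - 1 choose (p ^ r - 1))"
    using prime_gt_0_nat[OF p] by simp
  then show "\<not> p dvd (p ^ r * m - 1 choose (p ^ r - 1))" using * by (metis dvd_mult)
qed

lemma s_vec_prime_power:
  assumes "card I = p ^ r" "card J = p ^ s" "r \<le> s" "p > 0"
  shows "s_vec I J = frag_cmul (int (p ^ (s - r))) (\<Sum>i\<in>I. frag_of i) - (\<Sum>j\<in>J. frag_of j)"
proof -
  have "gcd (int (card I)) (int (card J)) = int (p ^ r)"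
    unfolding assms(1,2) by (simp add: le_imp_power_dvd[OF assms(3)] gcd_proj1_iff)
  moreover have "int (p ^ s) div int (p ^ r) = int (p ^ (s - r))"
    using assms(3,4) by (simp add: power_diff zdiv_int[symmetric] flip: of_nat_power)
  ultimately show ?thesis using assms(1,2,4) by (simp add: s_vec_def)
qed

text \<open>The sum of all \<open>y\<^bsub>I,J\<^esub>\<close> with \<open>I\<close> in one level set and \<open>J\<close> in the other.\<close>

lemma liftable_prime_power_subsets:
  assumes n: "n \<ge> 2" and x: "x \<in> carrier (root_lattice n)" and cd: "c \<noteq> d"
    and p: "p \<in> prime_divs n" and rs: "1 \<le> r" "r \<le> s"
  defines "O1 \<equiv> level n x c" and "O2 \<equiv> level n x d"
  defines "\<alpha> \<equiv> (card O2 choose p ^ s) * p ^ (s - r) * (card O1 - 1 choose (p ^ r - 1))"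
    and "\<beta> \<equiv> (card O1 choose p ^ r) * (card O2 - 1 choose (p ^ s - 1))"
  shows "frag_cmul (int \<alpha>) (\<Sum>i\<in>O1. frag_of i) - frag_cmul (int \<beta>) (\<Sum>i\<in>O2. frag_of i)
           \<in> liftable n x"
proof -
  define X where "X = subsets_of_card O1 (p ^ r)"
  define Y where "Y = subsets_of_card O2 (p ^ s)"
  define T where "T = X \<times> Y"
  have p0: "p > 0" using p by (simp add: prime_divs_def prime_gt_0_nat)
  have fin: "finite O1" "finite O2" by (simp_all add: O1_def O2_def finite_level)
  have finT: "finite X" "finite Y" "finite T"
    using fin by (simp_all add: X_def Y_def T_def finite_subsets_of_card)
  have T: "T \<subseteq> Qp_basis n p"
  proof
    fix b assume "b \<in> T"
    then obtain I J where b: "b = (I, J)" and I: "I \<subseteq> O1" "card I = p ^ r"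
      and J: "J \<subseteq> O2" "card J = p ^ s"
      by (auto simp: T_def X_def Y_def subsets_of_card_def)
    have "I \<noteq> {}" "J \<noteq> {}" using I(2) J(2) p0 by auto
    moreover have "I \<subseteq> {1..n}" "J \<subseteq> {1..n}"
      using I(1) J(1) level_subset unfolding O1_def O2_def by blast+
    moreover have "I \<inter> J = {}"
      using I(1) J(1) level_disjoint[OF cd] unfolding O1_def O2_def by blast
    ultimately show "b \<in> Qp_basis n p" using I(2) J(2) rs unfolding b Qp_basis_def by blast
  qed
  have sum_T: "(\<Sum>(I, J)\<in>T. s_vec I J)
      = frag_cmul (int \<alpha>) (\<Sum>i\<in>O1. frag_of i) - frag_cmul (int \<beta>) (\<Sum>i\<in>O2. frag_of i)"
  proof -
    have "(\<Sum>(I, J)\<in>T. s_vec I J)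
        = (\<Sum>(I, J)\<in>X \<times> Y. frag_cmul (int (p ^ (s - r))) (\<Sum>i\<in>I. frag_of i) - (\<Sum>j\<in>J. frag_of j))"
      unfolding T_def
      by (rule sum.cong)
         (auto simp: X_def Y_def subsets_of_card_def simp del: of_nat_power intro!: s_vec_prime_power rs(2) p0)
    also have "\<dots> = (\<Sum>I\<in>X. \<Sum>J\<in>Y. frag_cmul (int (p ^ (s - r))) (\<Sum>i\<in>I. frag_of i) - (\<Sum>j\<in>J. frag_of j))"
      by (simp only: sum.cartesian_product)
    also have "\<dots> = frag_cmul (int (card Y)) (frag_cmul (int (p ^ (s - r))) (\<Sum>I\<in>X. \<Sum>i\<in>I. frag_of i))
        - frag_cmul (int (card X)) (\<Sum>J\<in>Y. \<Sum>j\<in>J. frag_of j)"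
      by (simp only: sum_subtractf sum_const_frag frag_cmul_sum)
    finally show ?thesis
      using p0 fin by (simp add: X_def Y_def sum_subsets_of_card card_subsets_of_card \<alpha>_def \<beta>_def
          mult.assoc)
  qed
  show ?thesis
  proof (rule liftableI[OF n, where u = 0
        and z = "\<lambda>q\<in>prime_divs n. if q = p then (\<Sum>b\<in>T. frag_of b) else 0"])
    show "Poly_Mapping.keys ((\<lambda>q\<in>prime_divs n. if q = p then (\<Sum>b\<in>T. frag_of b) else 0) q) \<subseteq> Qp_basis n q"
      if "q \<in> prime_divs n" for q
      using T that by (simp add: keys_sum_frag_of[OF finT(3)])
    show "Qp_act \<sigma> ((\<lambda>q\<in>prime_divs n. if q = p then (\<Sum>b\<in>T. frag_of b) else 0) q)
        = (\<lambda>q\<in>prime_divs n. if q = p then (\<Sum>b\<in>T. frag_of b) else 0) q"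
      if \<sigma>: "\<sigma> permutes {1..n}" "root_act \<sigma> x = x" and q: "q \<in> prime_divs n" for \<sigma> q
    proof -
      have img: "\<sigma> ` I \<in> subsets_of_card (level n x e) k" if "I \<in> subsets_of_card (level n x e) k" for I e k
      proof -
        have "\<sigma> ` I \<subseteq> \<sigma> ` level n x e" using that by (auto simp: subsets_of_card_def)
        moreover have "card (\<sigma> ` I) = card I" by (rule card_image[OF permutes_inj_on[OF \<sigma>(1)]])
        ultimately show ?thesis
          using that unfolding image_level[OF \<sigma>(1) x \<sigma>(2)] by (simp add: subsets_of_card_def)
      qed
      have "frag_map (map_prod (image \<sigma>) (image \<sigma>)) (\<Sum>b\<in>T. frag_of b) = (\<Sum>b\<in>T. frag_of b)"
      proof (rule frag_map_sum_fixed[OF finT(3)])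
        show "inj_on (map_prod (image \<sigma>) (image \<sigma>)) T"
          unfolding T_def by (intro map_prod_inj_on inj_on_image permutes_inj_on[OF \<sigma>(1)])
        show "map_prod (image \<sigma>) (image \<sigma>) b \<in> T" if "b \<in> T" for b
          using that img unfolding T_def X_def Y_def O1_def O2_def by (cases b) simp
      qed
      then show ?thesis using q by (simp add: linear_perm_Q)
    qed
    have "(\<Sum>q\<in>prime_divs n. frag_extend (\<lambda>(I, J). s_vec I J)
          ((\<lambda>q\<in>prime_divs n. if q = p then (\<Sum>b\<in>T. frag_of b) else 0) q))
        = (\<Sum>q\<in>prime_divs n. if q = p then (\<Sum>(I, J)\<in>T. s_vec I J) else 0)"
      by (rule sum.cong) (simp_all add: frag_extend_sum[OF finT(3)] comp_def)
    also have "\<dots> = (\<Sum>(I, J)\<in>T. s_vec I J)"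
      using p finite_prime_divs[OF n] by simp
    finally show "resolution_map n (0, \<lambda>q\<in>prime_divs n. if q = p then (\<Sum>b\<in>T. frag_of b) else 0)
      = frag_cmul (int \<alpha>) (\<Sum>i\<in>O1. frag_of i) - frag_cmul (int \<beta>) (\<Sum>i\<in>O2. frag_of i)"
      by (simp only: resolution_map_def sum_T prod.case frag_extend_0 add_0)
  qed (simp_all add: linear_perm_Q)
qed

text \<open>Let \<open>r\<close> and \<open>s\<close> be the \<open>p\<close>-adic valuations of the sizes at \<open>c\<close> and \<open>d\<close>. If \<open>r = 0\<close>, pairs of points
  suffice; otherwise \<open>1 \<le> r \<le> s\<close>, which is what the basis of \<open>Q\<^sub>p\<close> requires of its subsets.\<close>

lemma liftable_pair:
  fixes p :: nat
  assumes n: "n \<ge> 2" and x: "x \<in> carrier (root_lattice n)" and cd: "c \<noteq> d" and p: "prime p"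
    and O1: "level n x c \<noteq> {}" and O2: "level n x d \<noteq> {}"
    and mult: "multiplicity p (card (level n x c)) \<le> multiplicity p (card (level n x d))"
    and dvd: "p dvd card (level n x c) \<Longrightarrow> p dvd n"
  shows "\<exists>\<alpha> \<beta>. \<not> int p dvd \<beta> \<and>
    frag_cmul \<alpha> (\<Sum>i\<in>level n x c. frag_of i) - frag_cmul \<beta> (\<Sum>i\<in>level n x d. frag_of i) \<in> liftable n x"
proof (cases "p dvd card (level n x c)")
  case False
  then have "\<not> int p dvd int (card (level n x c))" by simp
  with liftable_points[OF n x cd] show ?thesis by blast
next
  case True
  let ?r = "multiplicity p (card (level n x c))" and ?s = "multiplicity p (card (level n x d))"
  have card0: "card (level n x c) \<noteq> 0" "card (level n x d) \<noteq> 0"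
    using O1 O2 by (simp_all add: finite_level)
  have r: "1 \<le> ?r" using True card0(1) p by (simp add: prime_multiplicity_gt_zero_iff Suc_le_eq)
  have pp: "p \<in> prime_divs n" using p dvd[OF True] by (simp add: prime_divs_def)
  have unit: "\<not> is_unit p" using p by auto
  obtain m where m: "card (level n x c) = p ^ ?r * m" "\<not> p dvd m"
    by (rule multiplicity_decompose'[OF card0(1) unit])
  obtain m' where m': "card (level n x d) = p ^ ?s * m'" "\<not> p dvd m'"
    by (rule multiplicity_decompose'[OF card0(2) unit])
  have "\<not> p dvd (card (level n x c) choose p ^ ?r) * (card (level n x d) - 1 choose (p ^ ?s - 1))"
    using prime_not_dvd_binomial(1)[OF p m(2), of ?r] prime_not_dvd_binomial(2)[OF p m'(2), of ?s]
    unfolding prime_dvd_mult_iff[OF p] m(1)[symmetric] m'(1)[symmetric] by blast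
  then have "\<not> int p dvd
      int ((card (level n x c) choose p ^ ?r) * (card (level n x d) - 1 choose (p ^ ?s - 1)))"
    by (simp only: int_dvd_int_iff) simp
  with liftable_prime_power_subsets[OF n x cd pp r mult] show ?thesis by blast
qed

lemma level_decomposition:
  assumes "Poly_Mapping.keys x \<subseteq> {1..n}"
  defines "C \<equiv> Poly_Mapping.lookup x ` {1..n}"
  shows "x = (\<Sum>c\<in>C. frag_cmul c (\<Sum>i\<in>level n x c. frag_of i))"
proof (rule poly_mapping_eqI)
  fix k
  have "Poly_Mapping.lookup (\<Sum>c\<in>C. frag_cmul c (\<Sum>i\<in>level n x c. frag_of i)) k
      = (\<Sum>c\<in>C. if k \<in> level n x c then c else 0)"
    unfolding lookup_sum[of _ C] by (rule sum.cong) (simp_all add: lookup_sum_frag_of finite_level)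
  also have "\<dots> = (\<Sum>c\<in>C. if c = Poly_Mapping.lookup x k then (if k \<in> {1..n} then c else 0) else 0)"
    by (rule sum.cong) (auto simp: level_def)
  also have "\<dots> = Poly_Mapping.lookup x k"
  proof (cases "k \<in> {1..n}")
    case True
    then have "Poly_Mapping.lookup x k \<in> C" unfolding C_def by blast
    then show ?thesis using True by (simp add: C_def)
  next
    case False
    then have "Poly_Mapping.lookup x k = 0" using assms(1) by (auto simp: in_keys_iff)
    then show ?thesis using False by (simp add: C_def)
  qed
  finally show "Poly_Mapping.lookup x k
    = Poly_Mapping.lookup (\<Sum>c\<in>C. frag_cmul c (\<Sum>i\<in>level n x c. frag_of i)) k" by simp
qed

lemma card_levels: "(\<Sum>c\<in>Poly_Mapping.lookup x ` {1..n}. card (level n x c)) = n"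
proof -
  have "(\<Sum>c\<in>Poly_Mapping.lookup x ` {1..n}. card (level n x c))
      = card (\<Union>c\<in>Poly_Mapping.lookup x ` {1..n}. level n x c)"
    by (rule card_UN_disjoint[symmetric]) (auto simp: finite_level level_disjoint)
  also have "(\<Union>c\<in>Poly_Mapping.lookup x ` {1..n}. level n x c) = {1..n}"
    by (auto simp: level_def)
  finally show ?thesis by simp
qed

lemma coeff_sum_level: "coeff_sum n (\<Sum>i\<in>level n x c. frag_of i) = int (card (level n x c))"
proof -
  have "coeff_sum n (\<Sum>i\<in>level n x c. frag_of i) = (\<Sum>i\<in>level n x c. 1)"
    unfolding coeff_sum_sum using level_subset
    by (intro sum.cong refl coeff_sum_frag_of) blast
  then show ?thesis by simp
qed

text \<open>Let \<open>c\<^sub>0\<close> be a value whose level set has minimal \<open>p\<close>-adic valuation. If \<open>p\<close> divides the size of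
  this level set, then it divides all of them and hence \<open>n\<close>, so that \<open>Q\<^sub>p\<close> is present. After scaling \<open>x\<close> by
  an integer prime to \<open>p\<close>, the lifts with the remaining level sets clear every coefficient of \<open>x\<close> except
  the one at \<open>c\<^sub>0\<close>, and that coefficient must vanish because the coordinates sum to zero.\<close>

lemma multiple_liftable:
  fixes p :: nat
  assumes n: "n \<ge> 2" and x: "x \<in> carrier (root_lattice n)" and p: "prime p"
  shows "\<exists>m. \<not> int p dvd m \<and> frag_cmul m x \<in> liftable n x"
proof -
  define C where "C = Poly_Mapping.lookup x ` {1..n}"
  define e where "e c = (\<Sum>i\<in>level n x c. frag_of i)" for c
  have finC: "finite C" and C0: "C \<noteq> {}" using n by (auto simp: C_def)
  have level0: "level n x c \<noteq> {}" if "c \<in> C" for c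
    using that by (auto simp: C_def level_def)
  obtain c0 where c0: "c0 \<in> C"
    and min: "\<And>c. c \<in> C \<Longrightarrow> multiplicity p (card (level n x c0)) \<le> multiplicity p (card (level n x c))"
    using ex_is_arg_min_if_finite[OF finC C0, of "\<lambda>c. multiplicity p (card (level n x c))"]
    by (auto simp: is_arg_min_linorder)
  have dvd: "p dvd n" if "p dvd card (level n x c0)"
  proof -
    have "p dvd card (level n x c)" if c: "c \<in> C" for c
    proof -
      have "card (level n x c) \<noteq> 0" "card (level n x c0) \<noteq> 0"
        using level0 c c0 by (simp_all add: finite_level)
      then show ?thesis
        using min[OF c] \<open>p dvd card (level n x c0)\<close> p
        by (metis not_gr_zero not_dvd_imp_multiplicity_0 prime_multiplicity_gt_zero_iff le_zero_eq
            prime_imp_prime_elem)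
    qed
    then have "p dvd (\<Sum>c\<in>C. card (level n x c))" by (rule dvd_sum)
    then show ?thesis by (simp only: C_def card_levels)
  qed
  have "\<exists>\<alpha> \<beta>. \<not> int p dvd \<beta> \<and> frag_cmul \<alpha> (e c0) - frag_cmul \<beta> (e c) \<in> liftable n x"
    if "c \<in> C - {c0}" for c
    unfolding e_def using that c0 min dvd level0
    by (intro liftable_pair[OF n x _ p]) auto
  then obtain \<alpha> \<beta> where \<beta>: "\<And>c. c \<in> C - {c0} \<Longrightarrow> \<not> int p dvd \<beta> c"
    and lift: "\<And>c. c \<in> C - {c0} \<Longrightarrow> frag_cmul (\<alpha> c) (e c0) - frag_cmul (\<beta> c) (e c) \<in> liftable n x"
    by metis
  define m where "m = (\<Prod>c\<in>C - {c0}. \<beta> c)"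
  have m: "\<not> int p dvd m"
    using \<beta> finC p by (simp add: m_def prime_dvd_prod_iff)
  have m_div: "m div \<beta> c * \<beta> c = m" if "c \<in> C - {c0}" for c
    unfolding m_def by (rule dvd_div_mult_self, rule dvd_prodI) (use finC that in auto)
  define w where "w = (\<Sum>c\<in>C - {c0}. frag_cmul (m div \<beta> c * c) (frag_cmul (\<alpha> c) (e c0) - frag_cmul (\<beta> c) (e c)))"
  have w: "w \<in> liftable n x"
    unfolding w_def by (intro liftable_sum[OF n] liftable_cmul[OF n] lift)
  define \<gamma> where "\<gamma> = m * c0 + (\<Sum>c\<in>C - {c0}. m div \<beta> c * c * \<alpha> c)"
  have decomp: "x = frag_cmul c0 (e c0) + (\<Sum>c\<in>C - {c0}. frag_cmul c (e c))"
    using level_decomposition[of x n] x sum.remove[OF finC c0, of "\<lambda>c. frag_cmul c (e c)"]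
    unfolding mem_root_lattice_iff C_def e_def by argo
  have eq: "frag_cmul m x + w = frag_cmul \<gamma> (e c0)"
  proof (rule poly_mapping_eqI)
    fix k
    have "Poly_Mapping.lookup x k = c0 * Poly_Mapping.lookup (e c0) k
        + (\<Sum>c\<in>C - {c0}. c * Poly_Mapping.lookup (e c) k)"
      using arg_cong[OF decomp, of "\<lambda>x. Poly_Mapping.lookup x k"]
      by (simp only: lookup_add lookup_sum lookup_frag_cmul)
    moreover have "Poly_Mapping.lookup w k
        = (\<Sum>c\<in>C - {c0}. m div \<beta> c * c * \<alpha> c * Poly_Mapping.lookup (e c0) k
             - m * c * Poly_Mapping.lookup (e c) k)"
      unfolding w_def lookup_sum
    proof (rule sum.cong[OF refl])
      fix c assume "c \<in> C - {c0}"
      from m_div[OF this] have "m div \<beta> c * c * (\<beta> c * y) = m * c * y" for y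
        by (metis mult.assoc mult.commute)
      then show "Poly_Mapping.lookup (frag_cmul (m div \<beta> c * c) (frag_cmul (\<alpha> c) (e c0) - frag_cmul (\<beta> c) (e c))) k
        = m div \<beta> c * c * \<alpha> c * Poly_Mapping.lookup (e c0) k - m * c * Poly_Mapping.lookup (e c) k"
        by (simp add: lookup_minus right_diff_distrib mult.assoc)
    qed
    ultimately show "Poly_Mapping.lookup (frag_cmul m x + w) k = Poly_Mapping.lookup (frag_cmul \<gamma> (e c0)) k"
      by (simp add: lookup_add \<gamma>_def sum_subtractf sum_distrib_left sum_distrib_right distrib_left
          distrib_right mult.assoc)
  qed
  \<comment> \<open>Both sides of the equation lie in the root lattice, which forces \<open>\<gamma> = 0\<close>.\<close>
  have "coeff_sum n w = 0" "coeff_sum n x = 0"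
    using w x liftable_subset_root_lattice[OF n] unfolding mem_root_lattice_iff subset_iff by blast+
  then have "\<gamma> * int (card (level n x c0)) = 0"
    using arg_cong[OF eq, of "coeff_sum n"]
    by (simp add: coeff_sum_add coeff_sum_cmul e_def coeff_sum_level)
  then have "\<gamma> = 0" using level0[OF c0] by (simp add: finite_level)
  then have "frag_cmul m x = - w" using eq by (simp add: eq_neg_iff_add_eq_0)
  then show ?thesis using m liftable_minus[OF n w] by auto
qed

text \<open>The integers \<open>m\<close> such that \<open>m x\<close> lifts form an ideal; no prime number divides all of its elements, so it contains 1.\<close>

theorem self_liftable:
  assumes n: "n \<ge> 2" and x: "x \<in> carrier (root_lattice n)"
  shows "x \<in> liftable n x"
proof -
  let ?A = "{m. frag_cmul m x \<in> liftable n x}"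
  obtain d where d: "d \<in> ?A" "\<And>a. a \<in> ?A \<Longrightarrow> d dvd a"
  proof (rule int_subgroup_generator[of ?A])
    show "0 \<in> ?A" using zero_liftable[OF n] by simp
    show "a - b \<in> ?A" if "a \<in> ?A" "b \<in> ?A" for a b
      using that liftable_diff[OF n] by (simp add: frag_cmul_diff_distrib)
  qed blast
  have "is_unit d"
  proof (rule ccontr)
    assume "\<not> is_unit d"
    then have "nat \<bar>d\<bar> \<noteq> 1" by auto
    then obtain p where p: "prime p" "int p dvd d"
      using prime_factor_nat[of "nat \<bar>d\<bar>"] by auto
    from multiple_liftable[OF n x p(1)] obtain m where "\<not> int p dvd m" "m \<in> ?A" by blast
    then show False using d(2) p(2) dvd_trans by blast
  qed
  then have "d * d = 1" by (auto simp: zdvd1_eq abs_if split: if_splits)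
  then show ?thesis using liftable_cmul[OF n, of "frag_cmul d x" x d] d(1) by simp
qed


section \<open>The orbit of ordered pairs\<close>

text \<open>A left coset of the pointwise stabiliser of \<open>n - 1\<close> and \<open>n\<close> is the set of all permutations
  with prescribed values at these two points.\<close>

definition pair_coset :: "nat \<Rightarrow> nat \<times> nat \<Rightarrow> (nat \<Rightarrow> nat) set" where
  "pair_coset n b = {g. g permutes {1..n} \<and> (g (n - 1), g n) = b}"

lemma l_coset_eq_pair_coset:
  assumes n: "n \<ge> 2" and g: "g permutes {1..n}"
  shows "g <#\<^bsub>sym_group n\<^esub> carrier (sym_group (n - 2)) = pair_coset n (g (n - 1), g n)"
proof (rule subset_antisym; rule subsetI)
  fix k assume "k \<in> g <#\<^bsub>sym_group n\<^esub> carrier (sym_group (n - 2))"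
  then obtain h where h: "h permutes {1..n - 2}" and k: "k = g \<circ> h"
    by (auto simp: l_coset_def sym_group_mult sym_group_carrier)
  have "h permutes {1..n}" by (rule permutes_subset[OF h]) auto
  moreover have "h (n - 1) = n - 1" "h n = n" using n by (auto intro!: permutes_not_in[OF h])
  ultimately show "k \<in> pair_coset n (g (n - 1), g n)"
    using g k by (simp add: pair_coset_def permutes_compose)
next
  fix k assume "k \<in> pair_coset n (g (n - 1), g n)"
  then have k: "k permutes {1..n}" and eq: "k (n - 1) = g (n - 1)" "k n = g n"
    by (simp_all add: pair_coset_def)
  let ?h = "inv' g \<circ> k"
  have h: "?h permutes {1..n}" by (intro permutes_compose k permutes_inv g)
  have "?h permutes {1..n - 2}"
  proof (rule permutes_superset[OF h])
    fix i assume "i \<in> {1..n} - {1..n - 2}"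
    then have "i = n - 1 \<or> i = n" by auto
    then show "?h i = i" using eq permutes_inverses(2)[OF g] by auto
  qed
  moreover have "k = g \<circ> ?h" by (simp add: fun_eq_iff permutes_inverses(1)[OF g])
  ultimately show "k \<in> g <#\<^bsub>sym_group n\<^esub> carrier (sym_group (n - 2))"
    by (auto simp: l_coset_def sym_group_mult sym_group_carrier)
qed

text \<open>A transposition first brings \<open>i\<close> to its place; a second one repairs the value at \<open>n\<close> and leaves
  the position \<open>n - 1\<close> alone, because \<open>j \<noteq> i\<close>.\<close>

lemma permutation_with_two_values:
  fixes n :: nat
  assumes n: "n \<ge> 2" and ij: "i \<in> {1..n}" "j \<in> {1..n}" "i \<noteq> j"
  shows "\<exists>g. g permutes {1..n} \<and> g (n - 1) = i \<and> g n = j"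
proof -
  define t where "t = transpose i (n - 1)"
  define k where "k = t j"
  have t: "t permutes {1..n}" unfolding t_def using ij n by (intro permutes_swap_id) auto
  have k: "k \<in> {1..n}" unfolding k_def using ij(2) permutes_in_image[OF t] by blast
  have kn: "k \<noteq> n - 1" unfolding k_def t_def using ij(3) by (auto simp: transpose_def split: if_splits)
  let ?g = "t \<circ> transpose n k"
  have "?g permutes {1..n}" using k n by (intro permutes_compose permutes_swap_id t) auto
  moreover have "?g (n - 1) = i" using kn n by (simp add: t_def transpose_def)
  moreover have "?g n = j" by (simp add: k_def t_def)
  ultimately show ?thesis by blast
qed

lemma bij_betw_pair_coset:
  assumes n: "n \<ge> 2"
  shows "bij_betw (pair_coset n) (Q0_basis n)
    ((\<lambda>g. g <#\<^bsub>sym_group n\<^esub> carrier (sym_group (n - 2))) ` carrier (sym_group n))"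
proof -
  have ex: "\<exists>g. g permutes {1..n} \<and> (g (n - 1), g n) = b" if b: "b \<in> Q0_basis n" for b
  proof -
    obtain i j where "b = (i, j)" "i \<in> {1..n}" "j \<in> {1..n}" "i \<noteq> j"
      using b unfolding Q0_basis_def by blast
    with permutation_with_two_values[OF n, of i j] show ?thesis by auto
  qed
  have mem: "(g (n - 1), g n) \<in> Q0_basis n" if g: "g permutes {1..n}" for g
  proof -
    have "n - 1 \<in> {1..n}" "n \<in> {1..n}" using n by auto
    then have "g (n - 1) \<in> {1..n}" "g n \<in> {1..n}" using permutes_in_image[OF g] by blast+
    moreover have "g (n - 1) \<noteq> g n" using n by (simp add: inj_eq[OF permutes_inj[OF g]])
    ultimately show ?thesis unfolding Q0_basis_def by blast
  qed
  have inj: "inj_on (pair_coset n) (Q0_basis n)"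
  proof (rule inj_onI)
    fix b b' assume b: "b \<in> Q0_basis n" and eq: "pair_coset n b = pair_coset n b'"
    obtain g where "g permutes {1..n}" "(g (n - 1), g n) = b" using ex[OF b] by blast
    then have "g \<in> pair_coset n b" by (simp add: pair_coset_def)
    then show "b = b'" using eq by (auto simp: pair_coset_def)
  qed
  have "pair_coset n ` Q0_basis n
      = (\<lambda>g. g <#\<^bsub>sym_group n\<^esub> carrier (sym_group (n - 2))) ` carrier (sym_group n)"
  proof (rule subset_antisym; rule image_subsetI)
    fix b assume "b \<in> Q0_basis n"
    then obtain g where g: "g permutes {1..n}" "(g (n - 1), g n) = b" using ex by blast
    then have "pair_coset n b = g <#\<^bsub>sym_group n\<^esub> carrier (sym_group (n - 2))"
      by (simp only: l_coset_eq_pair_coset[OF n])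
    then show "pair_coset n b
        \<in> (\<lambda>g. g <#\<^bsub>sym_group n\<^esub> carrier (sym_group (n - 2))) ` carrier (sym_group n)"
      using g(1) by (simp add: sym_group_carrier)
  next
    fix g assume "g \<in> carrier (sym_group n)"
    then have "g permutes {1..n}" by (simp add: sym_group_carrier)
    then show "g <#\<^bsub>sym_group n\<^esub> carrier (sym_group (n - 2)) \<in> pair_coset n ` Q0_basis n"
      using mem by (simp only: l_coset_eq_pair_coset[OF n] image_eqI[OF refl])
  qed
  with inj show ?thesis by (simp add: bij_betw_def)
qed

lemma l_coset_pair_coset:
  assumes \<sigma>: "\<sigma> permutes {1..n}"
  shows "\<sigma> <#\<^bsub>sym_group n\<^esub> pair_coset n b = pair_coset n (map_prod \<sigma> \<sigma> b)"
proof (rule subset_antisym; rule subsetI)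
  fix k assume "k \<in> \<sigma> <#\<^bsub>sym_group n\<^esub> pair_coset n b"
  then show "k \<in> pair_coset n (map_prod \<sigma> \<sigma> b)"
    by (auto simp: l_coset_def sym_group_mult pair_coset_def simp del: One_nat_def
        intro: permutes_compose[OF _ \<sigma>])
next
  fix k assume k: "k \<in> pair_coset n (map_prod \<sigma> \<sigma> b)"
  let ?g = "inv' \<sigma> \<circ> k"
  have "?g permutes {1..n}"
    using k by (auto simp: pair_coset_def simp del: One_nat_def
        intro: permutes_compose permutes_inv[OF \<sigma>])
  moreover have "(?g (n - 1), ?g n) = b"
    using k permutes_inverses(2)[OF \<sigma>] by (cases b) (simp add: pair_coset_def)
  ultimately have "?g \<in> pair_coset n b" unfolding pair_coset_def by blast
  moreover have "k = \<sigma> \<circ> ?g" by (simp add: fun_eq_iff permutes_inverses(1)[OF \<sigma>])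
  ultimately show "k \<in> \<sigma> <#\<^bsub>sym_group n\<^esub> pair_coset n b"
    by (auto simp: l_coset_def sym_group_mult)
qed

lemma Q0_iso_coset_lattice:
  assumes "n \<ge> 2"
  shows "\<exists>\<theta> \<in> iso (Q0 n) (coset_lattice (sym_group n) (carrier (sym_group (n - 2)))).
    equivariant (sym_group n) (Q0 n) Q0_act (coset_act (sym_group n)) \<theta>"
proof
  show "frag_map (pair_coset n) \<in> iso (Q0 n) (coset_lattice (sym_group n) (carrier (sym_group (n - 2))))"
    unfolding Q0_def coset_lattice_def by (rule iso_frag_map[OF bij_betw_pair_coset[OF assms]])
  show "equivariant (sym_group n) (Q0 n) Q0_act (coset_act (sym_group n)) (frag_map (pair_coset n))"
    by (auto simp: equivariant_def linear_perm_Q coset_act_def linear_perm_eq_frag_map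
        frag_map_compose comp_def l_coset_pair_coset sym_group_carrier)
qed

section \<open>The resolution\<close>

theorem mainTheorem11:
  fixes n :: nat
  assumes "n \<ge> 2"
  shows
    "(\<exists>\<theta> \<in> iso (Q0 n) (coset_lattice (sym_group n) (carrier (sym_group (n - 2)))).
        equivariant (sym_group n) (Q0 n) Q0_act (coset_act (sym_group n)) \<theta>)
     \<and> resolution_map n ` carrier (Q_sum n) = carrier (root_lattice n)
     \<and> coflasque_resolution (sym_group n)
         (resolution_kernel n) (Q_act n) (Q_sum n) (Q_act n) (root_lattice n) root_act
         (\<lambda>x. x) (resolution_map n)"
proof (intro conjI)
  show "\<exists>\<theta> \<in> iso (Q0 n) (coset_lattice (sym_group n) (carrier (sym_group (n - 2)))).
      equivariant (sym_group n) (Q0 n) Q0_act (coset_act (sym_group n)) \<theta>"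
    by (rule Q0_iso_coset_lattice[OF assms])
  have lift: "\<exists>q\<in>carrier (Q_sum n). resolution_map n q = x \<and>
      (\<forall>\<sigma>\<in>carrier (sym_group n). root_act \<sigma> x = x \<longrightarrow> Q_act n \<sigma> q = q)"
    if "x \<in> carrier (root_lattice n)" for x
    using self_liftable[OF assms that] unfolding liftable_def by blast
  show "resolution_map n ` carrier (Q_sum n) = carrier (root_lattice n)"
    using lift resolution_map_mem[OF assms] by blast
  show "coflasque_resolution (sym_group n)
         (resolution_kernel n) (Q_act n) (Q_sum n) (Q_act n) (root_lattice n) root_act
         (\<lambda>x. x) (resolution_map n)"
    unfolding resolution_kernel_def
  proof (rule coflasque_resolution_kernelI)
    have "finite {p. p permutes {1..n}}" by (rule finite_permutations) simp
    then show "finite (carrier (sym_group n))" by (simp add: sym_group_def)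
  qed (use assms lift in \<open>auto intro: permutation_lattice_Q_sum G_lattice_root_lattice
      resolution_map_hom equivariant_resolution_map\<close>)
qed

end
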